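(* Let $T$ be a relative pseudomonad over a pseudofunctor $J\colon\mathcal{C}\to\mathcal{D}$ between bicategories, and let $G^T\colon\mathrm{Kl}(T)\to\mathcal{D}$ be the canonical pseudofunctor from its Kleisli bicategory, sending $X$ to $TX$. Then $G^T$ has a relative left pseudoadjoint $F^T$ over $J\colon\mathcal{C}\to\mathcal{D}$.
   Context: Associativity and unit isomorphisms of bicategories are suppressed; "$\cdot$" is vertical composition of 2-cells, juxtaposition is composition of morphisms and whiskering. Relative pseudomonad. A relative pseudomonad $T$ over $J\colon\mathcal{C}\to\mathcal{D}$ consists of: an object $TX\in\mathcal{D}$ for each $X\in\mathcal{C}$; functors $(-)^*\colon\mathcal{D}[JX,TY]\to\mathcal{D}[TX,TY]$ for $X,Y\in\mathcal{C}$; morphisms $i_X\colon JX\to TX$; invertible 2-cells $\mu_{g,f}\colon(g^*f)^*\to g^*f^*$, natural in $f\colon JX\to TY$, $g\colon JY\to TZ$; invertible 2-cells $\eta_f\colon f\to f^*i_X$, natural in $f\colon JX\to TY$; invertible 2-cells $\theta_X\colon (i_X)^*\to 1_{TX}$; such that (associativity) for $f\colon JX\to TY$, $g\colon JY\to TZ$, $h\colon JZ\to TV$: $(h^*\mu_{g,f})\cdot\mu_{h,g^*f}\cdot(\mu_{h,g}f)^*=(\mu_{h,g}f^* )\cdot\mu_{h^*g,f}$ as 2-cells $((h^*g)^*f)^*\to h^*g^*f^*$; (unit) for $f\colon JX\to TY$: $(f^*\theta_X)\cdot\mu_{f,i_X}\cdot(\eta_f)^*=1_{f^*}$. Kleisli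 bicategory. $\mathrm{Kl}(T)$ has the objects of $\mathcal{C}$ as objects and $\mathrm{Kl}(T)[X,Y]=\mathcal{D}[JX,TY]$. The composite of $f\colon JX\to TY$ and $g\colon JY\to TZ$ is $g\circ f=g^*f$; the identity on $X$ is $i_X$; the associativity, right unit and left unit isomorphisms are given by $\mu_{h,g}f\colon(h^*g)^*f\to h^*g^*f$, $\eta_f\colon f\to f^*i_X$ and $\theta_Yf\colon (i_Y)^*f\to f$. The pseudofunctor $G^T\colon\mathrm{Kl}(T)\to\mathcal{D}$ sends $X$ to $TX$, acts on hom-categories as $(-)^*\colon\mathcal{D}[JX,TY]\to\mathcal{D}[TX,TY]$, and has pseudofunctoriality 2-cells $\mu_{g,f}\colon G^T(g\circ f)\to G^T(g)G^T(f)$ and $\theta_X\colon G^T(i_X)\to1_{TX}$. Relative left pseudoadjoint. For a pseudofunctor $G\colon\mathcal{E}\to\mathcal{D}$, a relative left pseudoadjoint $F$ to $G$ over $J\colon\mathcal{C}\to\mathcal{D}$ consists of: an object $FX\in\mathcal{E}$ for every $X\in\mathcal{C}$; a morphism $i_X\colon JX\to GFX$ in $\mathcal{D}$ for every $X\in\mathcal{C}$; and, for every $X\in\mathcal{C}$, $A\in\mathcal{E}$, an adjoint equivalence whose right adjoint is $G(-)\,i_X\colon\mathcal{E}[FX,A]\to\mathcal{D}[JX,GA]$, with left adjoint denoted $(-)^\sharp\colon\mathcal{D}[JX,GA]\to\mathcal{E}[FX,A]$. *)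

theory Defs
  imports Main
begin

section \<open>Categories, functors, natural isomorphisms\<close>

record ('a, 'f) cat_data =
  Ob :: "'a set"
  Ar :: "'f set"
  Dom :: "'f \<Rightarrow> 'a"
  Cod :: "'f \<Rightarrow> 'a"
  Idn :: "'a \<Rightarrow> 'f"
  Vcomp :: "'f \<Rightarrow> 'f \<Rightarrow> 'f"  (infixl "\<cdot>\<index>" 70)

definition in_hom :: "('a, 'f) cat_data \<Rightarrow> 'f \<Rightarrow> 'a \<Rightarrow> 'a \<Rightarrow> bool"
  where "in_hom C f a b \<longleftrightarrow> f \<in> Ar C \<and> Dom C f = a \<and> Cod C f = b"

locale category =
  fixes C :: "('a, 'f) cat_data"
  assumes dom_ob: "f \<in> Ar C \<Longrightarrow> Dom C f \<in> Ob C"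
    and cod_ob: "f \<in> Ar C \<Longrightarrow> Cod C f \<in> Ob C"
    and id_in_hom: "a \<in> Ob C \<Longrightarrow> in_hom C (Idn C a) a a"
    and comp_in_hom: "\<lbrakk>in_hom C f a b; in_hom C g b c\<rbrakk> \<Longrightarrow> in_hom C (g \<cdot>\<^bsub>C\<^esub> f) a c"
    and comp_id: "in_hom C f a b \<Longrightarrow> f \<cdot>\<^bsub>C\<^esub> Idn C a = f"
    and id_comp: "in_hom C f a b \<Longrightarrow> Idn C b \<cdot>\<^bsub>C\<^esub> f = f"
    and comp_assoc: "\<lbrakk>in_hom C f a b; in_hom C g b c; in_hom C h c d\<rbrakk>
      \<Longrightarrow> (h \<cdot>\<^bsub>C\<^esub> g) \<cdot>\<^bsub>C\<^esub> f = h \<cdot>\<^bsub>C\<^esub> (g \<cdot>\<^bsub>C\<^esub> f)"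

definition inverse_arrows :: "('a, 'f) cat_data \<Rightarrow> 'f \<Rightarrow> 'f \<Rightarrow> bool"
  where "inverse_arrows C f g \<longleftrightarrow>
    in_hom C f (Dom C f) (Cod C f) \<and> in_hom C g (Cod C f) (Dom C f) \<and>
    g \<cdot>\<^bsub>C\<^esub> f = Idn C (Dom C f) \<and> f \<cdot>\<^bsub>C\<^esub> g = Idn C (Cod C f)"

definition iso :: "('a, 'f) cat_data \<Rightarrow> 'f \<Rightarrow> bool"
  where "iso C f \<longleftrightarrow> (\<exists>g. inverse_arrows C f g)"

definition inv_of :: "('a, 'f) cat_data \<Rightarrow> 'f \<Rightarrow> 'f"
  where "inv_of C f = (THE g. inverse_arrows C f g)"

definition prod_cat :: "('a, 'f) cat_data \<Rightarrow> ('b, 'g) cat_data \<Rightarrow> ('a \<times> 'b, 'f \<times> 'g) cat_data"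
    (infixr "\<times>\<^sub>C" 75)
  where "C \<times>\<^sub>C D =
    \<lparr>Ob = Ob C \<times> Ob D, Ar = Ar C \<times> Ar D,
     Dom = map_prod (Dom C) (Dom D), Cod = map_prod (Cod C) (Cod D),
     Idn = map_prod (Idn C) (Idn D),
     Vcomp = (\<lambda>(g, g') (f, f'). (g \<cdot>\<^bsub>C\<^esub> f, g' \<cdot>\<^bsub>D\<^esub> f'))\<rparr>"

record ('a, 'f, 'b, 'g) functor_data =
  onOb :: "'a \<Rightarrow> 'b"
  onAr :: "'f \<Rightarrow> 'g"

locale cat_functor = dom: category C + cod: category D
  for C :: "('a, 'f) cat_data" and D :: "('b, 'g) cat_data" +
  fixes F :: "('a, 'f, 'b, 'g) functor_data"
  assumes ob: "a \<in> Ob C \<Longrightarrow> onOb F a \<in> Ob D"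
    and ar: "in_hom C f a b \<Longrightarrow> in_hom D (onAr F f) (onOb F a) (onOb F b)"
    and pres_id: "a \<in> Ob C \<Longrightarrow> onAr F (Idn C a) = Idn D (onOb F a)"
    and pres_comp: "\<lbrakk>in_hom C f a b; in_hom C g b c\<rbrakk>
      \<Longrightarrow> onAr F (g \<cdot>\<^bsub>C\<^esub> f) = onAr F g \<cdot>\<^bsub>D\<^esub> onAr F f"

definition id_functor :: "('a, 'f, 'a, 'f) functor_data"
  where "id_functor = \<lparr>onOb = (\<lambda>a. a), onAr = (\<lambda>f. f)\<rparr>"

definition comp_functor ::
  "('b, 'g, 'c, 'h) functor_data \<Rightarrow> ('a, 'f, 'b, 'g) functor_data \<Rightarrow> ('a, 'f, 'c, 'h) functor_data"
    (infixl "\<circ>\<^sub>F" 70)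
  where "G \<circ>\<^sub>F F = \<lparr>onOb = onOb G \<circ> onOb F, onAr = onAr G \<circ> onAr F\<rparr>"

definition prod_functor ::
  "('a, 'f, 'b, 'g) functor_data \<Rightarrow> ('c, 'h, 'd, 'k) functor_data
    \<Rightarrow> ('a \<times> 'c, 'f \<times> 'h, 'b \<times> 'd, 'g \<times> 'k) functor_data"  (infixr "\<times>\<^sub>F" 75)
  where "F \<times>\<^sub>F G =
    \<lparr>onOb = map_prod (onOb F) (onOb G), onAr = map_prod (onAr F) (onAr G)\<rparr>"

locale natural_iso = F: cat_functor C D F + G: cat_functor C D G
  for C :: "('a, 'f) cat_data" and D :: "('b, 'g) cat_data"
    and F G :: "('a, 'f, 'b, 'g) functor_data" +
  fixes t :: "'a \<Rightarrow> 'g"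
  assumes component: "a \<in> Ob C \<Longrightarrow> in_hom D (t a) (onOb F a) (onOb G a)"
    and component_iso: "a \<in> Ob C \<Longrightarrow> iso D (t a)"
    and natural: "in_hom C f a b \<Longrightarrow> t b \<cdot>\<^bsub>D\<^esub> onAr F f = onAr G f \<cdot>\<^bsub>D\<^esub> t a"

locale adjoint_equivalence =
  left: cat_functor C D L + right: cat_functor D C R +
  unit: natural_iso C C id_functor "R \<circ>\<^sub>F L" \<eta> +
  counit: natural_iso D D "L \<circ>\<^sub>F R" id_functor \<epsilon>
  for C :: "('a, 'f) cat_data" and D :: "('b, 'g) cat_data"
    and L :: "('a, 'f, 'b, 'g) functor_data" and R :: "('b, 'g, 'a, 'f) functor_data"
    and \<eta> :: "'a \<Rightarrow> 'f" and \<epsilon> :: "'b \<Rightarrow> 'g" +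
  assumes triangle_left:
      "a \<in> Ob C \<Longrightarrow> \<epsilon> (onOb L a) \<cdot>\<^bsub>D\<^esub> onAr L (\<eta> a) = Idn D (onOb L a)"
    and triangle_right:
      "b \<in> Ob D \<Longrightarrow> onAr R (\<epsilon> b) \<cdot>\<^bsub>C\<^esub> \<eta> (onOb R b) = Idn C (onOb R b)"

section \<open>Bicategories\<close>

text \<open>
  A bicategory is given by a family of hom-categories, indexed by pairs of objects. The
  hom-categories of different pairs may overlap, so every operation takes the objects
  involved as arguments. This allows the Kleisli bicategory to have literally the
  hom-categories \<open>D[JX, TY]\<close> even if \<open>J\<close> or \<open>T\<close> is not injective on objects.

  \<open>HComp B X Y Z\<close> is the composition functor \<open>B[Y, Z] \<times> B[X, Y] \<rightarrow> B[X, Z]\<close>. For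
  \<open>f : X \<rightarrow> Y\<close>, \<open>g : Y \<rightarrow> Z\<close> and \<open>h : Z \<rightarrow> W\<close>, the structural 2-cells are
  \<open>Assoc B X Y Z W (h, g, f) : (h g) f \<rightarrow> h (g f)\<close>, \<open>LUnit B X Y f : 1 f \<rightarrow> f\<close> and
  \<open>RUnit B X Y f : f 1 \<rightarrow> f\<close>.
\<close>

record ('o, 'm, 'c) bicat_data =
  Obj :: "'o set"
  Hom :: "'o \<Rightarrow> 'o \<Rightarrow> ('m, 'c) cat_data"
  HComp :: "'o \<Rightarrow> 'o \<Rightarrow> 'o \<Rightarrow> ('m \<times> 'm, 'c \<times> 'c, 'm, 'c) functor_data"
  One :: "'o \<Rightarrow> 'm"
  Assoc :: "'o \<Rightarrow> 'o \<Rightarrow> 'o \<Rightarrow> 'o \<Rightarrow> 'm \<times> 'm \<times> 'm \<Rightarrow> 'c"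
  LUnit :: "'o \<Rightarrow> 'o \<Rightarrow> 'm \<Rightarrow> 'c"
  RUnit :: "'o \<Rightarrow> 'o \<Rightarrow> 'm \<Rightarrow> 'c"

definition comp1 :: "('o, 'm, 'c) bicat_data \<Rightarrow> 'o \<Rightarrow> 'o \<Rightarrow> 'o \<Rightarrow> 'm \<Rightarrow> 'm \<Rightarrow> 'm"
  where "comp1 B X Y Z g f = onOb (HComp B X Y Z) (g, f)"

definition comp2 :: "('o, 'm, 'c) bicat_data \<Rightarrow> 'o \<Rightarrow> 'o \<Rightarrow> 'o \<Rightarrow> 'c \<Rightarrow> 'c \<Rightarrow> 'c"
  where "comp2 B X Y Z \<beta> \<alpha> = onAr (HComp B X Y Z) (\<beta>, \<alpha>)"

definition lwhisk :: "('o, 'm, 'c) bicat_data \<Rightarrow> 'o \<Rightarrow> 'o \<Rightarrow> 'o \<Rightarrow> 'm \<Rightarrow> 'c \<Rightarrow> 'c"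
  where "lwhisk B X Y Z g \<alpha> = comp2 B X Y Z (Idn (Hom B Y Z) g) \<alpha>"

definition rwhisk :: "('o, 'm, 'c) bicat_data \<Rightarrow> 'o \<Rightarrow> 'o \<Rightarrow> 'o \<Rightarrow> 'c \<Rightarrow> 'm \<Rightarrow> 'c"
  where "rwhisk B X Y Z \<beta> f = comp2 B X Y Z \<beta> (Idn (Hom B X Y) f)"

definition postcomp_functor ::
  "('o, 'm, 'c) bicat_data \<Rightarrow> 'o \<Rightarrow> 'o \<Rightarrow> 'o \<Rightarrow> 'm \<Rightarrow> ('m, 'c, 'm, 'c) functor_data"
  where "postcomp_functor B X Y Z g = \<lparr>onOb = comp1 B X Y Z g, onAr = lwhisk B X Y Z g\<rparr>"

definition precomp_functor ::
  "('o, 'm, 'c) bicat_data \<Rightarrow> 'o \<Rightarrow> 'o \<Rightarrow> 'o \<Rightarrow> 'm \<Rightarrow> ('m, 'c, 'm, 'c) functor_data"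
  where "precomp_functor B X Y Z f =
    \<lparr>onOb = (\<lambda>g. comp1 B X Y Z g f), onAr = (\<lambda>\<beta>. rwhisk B X Y Z \<beta> f)\<rparr>"

locale bicategory =
  fixes B :: "('o, 'm, 'c) bicat_data"
  assumes hom_category: "\<lbrakk>X \<in> Obj B; Y \<in> Obj B\<rbrakk> \<Longrightarrow> category (Hom B X Y)"
    and hcomp_functor: "\<lbrakk>X \<in> Obj B; Y \<in> Obj B; Z \<in> Obj B\<rbrakk>
      \<Longrightarrow> cat_functor (Hom B Y Z \<times>\<^sub>C Hom B X Y) (Hom B X Z) (HComp B X Y Z)"
    and one_hom: "X \<in> Obj B \<Longrightarrow> One B X \<in> Ob (Hom B X X)"
    and assoc_natural_iso: "\<lbrakk>X \<in> Obj B; Y \<in> Obj B; Z \<in> Obj B; W \<in> Obj B\<rbrakk>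
      \<Longrightarrow> natural_iso (Hom B Z W \<times>\<^sub>C Hom B Y Z \<times>\<^sub>C Hom B X Y) (Hom B X W)
            \<lparr>onOb = (\<lambda>(h, g, f). comp1 B X Y W (comp1 B Y Z W h g) f),
             onAr = (\<lambda>(\<gamma>, \<beta>, \<alpha>). comp2 B X Y W (comp2 B Y Z W \<gamma> \<beta>) \<alpha>)\<rparr>
            \<lparr>onOb = (\<lambda>(h, g, f). comp1 B X Z W h (comp1 B X Y Z g f)),
             onAr = (\<lambda>(\<gamma>, \<beta>, \<alpha>). comp2 B X Z W \<gamma> (comp2 B X Y Z \<beta> \<alpha>))\<rparr>
            (Assoc B X Y Z W)"
    and lunit_natural_iso: "\<lbrakk>X \<in> Obj B; Y \<in> Obj B\<rbrakk>
      \<Longrightarrow> natural_iso (Hom B X Y) (Hom B X Y)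
            (postcomp_functor B X Y Y (One B Y)) id_functor (LUnit B X Y)"
    and runit_natural_iso: "\<lbrakk>X \<in> Obj B; Y \<in> Obj B\<rbrakk>
      \<Longrightarrow> natural_iso (Hom B X Y) (Hom B X Y)
            (precomp_functor B X X Y (One B X)) id_functor (RUnit B X Y)"
    and pentagon:
      "\<lbrakk>X \<in> Obj B; Y \<in> Obj B; Z \<in> Obj B; W \<in> Obj B; V \<in> Obj B;
        f \<in> Ob (Hom B X Y); g \<in> Ob (Hom B Y Z); h \<in> Ob (Hom B Z W); k \<in> Ob (Hom B W V)\<rbrakk>
      \<Longrightarrow> Assoc B X Z W V (k, h, comp1 B X Y Z g f)
            \<cdot>\<^bsub>Hom B X V\<^esub> Assoc B X Y Z V (comp1 B Z W V k h, g, f)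
          = lwhisk B X W V k (Assoc B X Y Z W (h, g, f))
            \<cdot>\<^bsub>Hom B X V\<^esub> Assoc B X Y W V (k, comp1 B Y Z W h g, f)
            \<cdot>\<^bsub>Hom B X V\<^esub> rwhisk B X Y V (Assoc B Y Z W V (k, h, g)) f"
    and triangle:
      "\<lbrakk>X \<in> Obj B; Y \<in> Obj B; Z \<in> Obj B; f \<in> Ob (Hom B X Y); g \<in> Ob (Hom B Y Z)\<rbrakk>
      \<Longrightarrow> lwhisk B X Y Z g (LUnit B X Y f) \<cdot>\<^bsub>Hom B X Z\<^esub> Assoc B X Y Y Z (g, One B Y, f)
          = rwhisk B X Y Z (RUnit B Y Z g) f"

section \<open>Pseudofunctors\<close>

text \<open>
  The comparison 2-cells are oriented as \<open>P(g f) \<rightarrow> P(g) P(f)\<close> and \<open>P(1) \<rightarrow> 1\<close>.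
\<close>

record ('o, 'm, 'c, 'p, 'n, 'd) pseudofunctor_data =
  PObj :: "'o \<Rightarrow> 'p"
  PHom :: "'o \<Rightarrow> 'o \<Rightarrow> ('m, 'c, 'n, 'd) functor_data"
  PComp :: "'o \<Rightarrow> 'o \<Rightarrow> 'o \<Rightarrow> 'm \<times> 'm \<Rightarrow> 'd"
  PUnit :: "'o \<Rightarrow> 'd"

locale pseudofunctor = dom: bicategory A + cod: bicategory B
  for A :: "('o, 'm, 'c) bicat_data" and B :: "('p, 'n, 'd) bicat_data" +
  fixes P :: "('o, 'm, 'c, 'p, 'n, 'd) pseudofunctor_data"
  assumes p_obj: "X \<in> Obj A \<Longrightarrow> PObj P X \<in> Obj B"
    and p_hom: "\<lbrakk>X \<in> Obj A; Y \<in> Obj A\<rbrakk>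
      \<Longrightarrow> cat_functor (Hom A X Y) (Hom B (PObj P X) (PObj P Y)) (PHom P X Y)"
    and p_comp: "\<lbrakk>X \<in> Obj A; Y \<in> Obj A; Z \<in> Obj A\<rbrakk>
      \<Longrightarrow> natural_iso (Hom A Y Z \<times>\<^sub>C Hom A X Y) (Hom B (PObj P X) (PObj P Z))
            (PHom P X Z \<circ>\<^sub>F HComp A X Y Z)
            (HComp B (PObj P X) (PObj P Y) (PObj P Z) \<circ>\<^sub>F (PHom P Y Z \<times>\<^sub>F PHom P X Y))
            (PComp P X Y Z)"
    and p_unit: "X \<in> Obj A \<Longrightarrow>
      in_hom (Hom B (PObj P X) (PObj P X)) (PUnit P X)
        (onOb (PHom P X X) (One A X)) (One B (PObj P X))"
    and p_unit_iso: "X \<in> Obj A \<Longrightarrow> iso (Hom B (PObj P X) (PObj P X)) (PUnit P X)"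
    and p_assoc:
      "\<lbrakk>X \<in> Obj A; Y \<in> Obj A; Z \<in> Obj A; W \<in> Obj A;
        f \<in> Ob (Hom A X Y); g \<in> Ob (Hom A Y Z); h \<in> Ob (Hom A Z W)\<rbrakk>
      \<Longrightarrow> Assoc B (PObj P X) (PObj P Y) (PObj P Z) (PObj P W)
              (onOb (PHom P Z W) h, onOb (PHom P Y Z) g, onOb (PHom P X Y) f)
            \<cdot>\<^bsub>Hom B (PObj P X) (PObj P W)\<^esub>
              rwhisk B (PObj P X) (PObj P Y) (PObj P W)
                (PComp P Y Z W (h, g)) (onOb (PHom P X Y) f)
            \<cdot>\<^bsub>Hom B (PObj P X) (PObj P W)\<^esub> PComp P X Y W (comp1 A Y Z W h g, f)
          = lwhisk B (PObj P X) (PObj P Z) (PObj P W)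
                (onOb (PHom P Z W) h) (PComp P X Y Z (g, f))
            \<cdot>\<^bsub>Hom B (PObj P X) (PObj P W)\<^esub> PComp P X Z W (h, comp1 A X Y Z g f)
            \<cdot>\<^bsub>Hom B (PObj P X) (PObj P W)\<^esub> onAr (PHom P X W) (Assoc A X Y Z W (h, g, f))"
    and p_lunit:
      "\<lbrakk>X \<in> Obj A; Y \<in> Obj A; f \<in> Ob (Hom A X Y)\<rbrakk>
      \<Longrightarrow> LUnit B (PObj P X) (PObj P Y) (onOb (PHom P X Y) f)
            \<cdot>\<^bsub>Hom B (PObj P X) (PObj P Y)\<^esub>
              rwhisk B (PObj P X) (PObj P Y) (PObj P Y) (PUnit P Y) (onOb (PHom P X Y) f)
            \<cdot>\<^bsub>Hom B (PObj P X) (PObj P Y)\<^esub> PComp P X Y Y (One A Y, f)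
          = onAr (PHom P X Y) (LUnit A X Y f)"
    and p_runit:
      "\<lbrakk>X \<in> Obj A; Y \<in> Obj A; f \<in> Ob (Hom A X Y)\<rbrakk>
      \<Longrightarrow> RUnit B (PObj P X) (PObj P Y) (onOb (PHom P X Y) f)
            \<cdot>\<^bsub>Hom B (PObj P X) (PObj P Y)\<^esub>
              lwhisk B (PObj P X) (PObj P X) (PObj P Y) (onOb (PHom P X Y) f) (PUnit P X)
            \<cdot>\<^bsub>Hom B (PObj P X) (PObj P Y)\<^esub> PComp P X X Y (f, One A X)
          = onAr (PHom P X Y) (RUnit A X Y f)"

section \<open>Relative pseudomonads\<close>

text \<open>
  \<open>Ext T X Y\<close> is the functor \<open>(-)* : D[JX, TY] \<rightarrow> D[TX, TY]\<close>, and \<open>Mu T X Y Z (g, f)\<close> is the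
  2-cell \<open>(g* f)* \<rightarrow> g* f*\<close> for \<open>f : JX \<rightarrow> TY\<close> and \<open>g : JY \<rightarrow> TZ\<close>.
\<close>

record ('co, 'o, 'm, 'c) rel_pseudomonad_data =
  TOb :: "'co \<Rightarrow> 'o"
  Ext :: "'co \<Rightarrow> 'co \<Rightarrow> ('m, 'c, 'm, 'c) functor_data"
  TUnit :: "'co \<Rightarrow> 'm"
  Mu :: "'co \<Rightarrow> 'co \<Rightarrow> 'co \<Rightarrow> 'm \<times> 'm \<Rightarrow> 'c"
  Eta :: "'co \<Rightarrow> 'co \<Rightarrow> 'm \<Rightarrow> 'c"
  Theta :: "'co \<Rightarrow> 'c"

definition kl_hcomp ::
  "('o, 'm, 'c) bicat_data \<Rightarrow> ('co, 'cm, 'cc, 'o, 'm, 'c) pseudofunctor_data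
    \<Rightarrow> ('co, 'o, 'm, 'c) rel_pseudomonad_data
    \<Rightarrow> 'co \<Rightarrow> 'co \<Rightarrow> 'co \<Rightarrow> ('m \<times> 'm, 'c \<times> 'c, 'm, 'c) functor_data"
  where \<comment> \<open>\<open>(g, f) \<mapsto> g* f\<close> for \<open>f : JX \<rightarrow> TY\<close> and \<open>g : JY \<rightarrow> TZ\<close>\<close>
    "kl_hcomp D J T X Y Z =
      HComp D (PObj J X) (TOb T Y) (TOb T Z) \<circ>\<^sub>F (Ext T Y Z \<times>\<^sub>F id_functor)"

text \<open>
  In the two coherence axioms the associativity and right unit 2-cells of \<open>D\<close> are
  inserted where an informal presentation suppresses them.
\<close>

locale relative_pseudomonad = J: pseudofunctor C D J
  for C :: "('co, 'cm, 'cc) bicat_data" and D :: "('o, 'm, 'c) bicat_data"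
    and J :: "('co, 'cm, 'cc, 'o, 'm, 'c) pseudofunctor_data" +
  fixes T :: "('co, 'o, 'm, 'c) rel_pseudomonad_data"
  assumes t_obj: "X \<in> Obj C \<Longrightarrow> TOb T X \<in> Obj D"
    and ext_functor: "\<lbrakk>X \<in> Obj C; Y \<in> Obj C\<rbrakk>
      \<Longrightarrow> cat_functor (Hom D (PObj J X) (TOb T Y)) (Hom D (TOb T X) (TOb T Y)) (Ext T X Y)"
    and t_unit: "X \<in> Obj C \<Longrightarrow> TUnit T X \<in> Ob (Hom D (PObj J X) (TOb T X))"
    and mu_natural_iso: "\<lbrakk>X \<in> Obj C; Y \<in> Obj C; Z \<in> Obj C\<rbrakk>
      \<Longrightarrow> natural_iso
            (Hom D (PObj J Y) (TOb T Z) \<times>\<^sub>C Hom D (PObj J X) (TOb T Y))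
            (Hom D (TOb T X) (TOb T Z))
            (Ext T X Z \<circ>\<^sub>F kl_hcomp D J T X Y Z)
            (HComp D (TOb T X) (TOb T Y) (TOb T Z) \<circ>\<^sub>F (Ext T Y Z \<times>\<^sub>F Ext T X Y))
            (Mu T X Y Z)"
    and eta_natural_iso: "\<lbrakk>X \<in> Obj C; Y \<in> Obj C\<rbrakk>
      \<Longrightarrow> natural_iso (Hom D (PObj J X) (TOb T Y)) (Hom D (PObj J X) (TOb T Y))
            id_functor
            (precomp_functor D (PObj J X) (TOb T X) (TOb T Y) (TUnit T X) \<circ>\<^sub>F Ext T X Y)
            (Eta T X Y)"
    and theta: "X \<in> Obj C \<Longrightarrow>
      in_hom (Hom D (TOb T X) (TOb T X)) (Theta T X)
        (onOb (Ext T X X) (TUnit T X)) (One D (TOb T X))"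
    and theta_iso: "X \<in> Obj C \<Longrightarrow> iso (Hom D (TOb T X) (TOb T X)) (Theta T X)"
    and t_assoc:
      "\<lbrakk>X \<in> Obj C; Y \<in> Obj C; Z \<in> Obj C; V \<in> Obj C;
        f \<in> Ob (Hom D (PObj J X) (TOb T Y)); g \<in> Ob (Hom D (PObj J Y) (TOb T Z));
        h \<in> Ob (Hom D (PObj J Z) (TOb T V))\<rbrakk>
      \<Longrightarrow> lwhisk D (TOb T X) (TOb T Z) (TOb T V) (onOb (Ext T Z V) h) (Mu T X Y Z (g, f))
            \<cdot>\<^bsub>Hom D (TOb T X) (TOb T V)\<^esub>
              Mu T X Z V (h, comp1 D (PObj J X) (TOb T Y) (TOb T Z) (onOb (Ext T Y Z) g) f)
            \<cdot>\<^bsub>Hom D (TOb T X) (TOb T V)\<^esub>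
              onAr (Ext T X V)
                (Assoc D (PObj J X) (TOb T Y) (TOb T Z) (TOb T V)
                    (onOb (Ext T Z V) h, onOb (Ext T Y Z) g, f)
                 \<cdot>\<^bsub>Hom D (PObj J X) (TOb T V)\<^esub>
                   rwhisk D (PObj J X) (TOb T Y) (TOb T V) (Mu T Y Z V (h, g)) f)
          = Assoc D (TOb T X) (TOb T Y) (TOb T Z) (TOb T V)
                (onOb (Ext T Z V) h, onOb (Ext T Y Z) g, onOb (Ext T X Y) f)
            \<cdot>\<^bsub>Hom D (TOb T X) (TOb T V)\<^esub>
              rwhisk D (TOb T X) (TOb T Y) (TOb T V) (Mu T Y Z V (h, g)) (onOb (Ext T X Y) f)
            \<cdot>\<^bsub>Hom D (TOb T X) (TOb T V)\<^esub>
              Mu T X Y V (comp1 D (PObj J Y) (TOb T Z) (TOb T V) (onOb (Ext T Z V) h) g, f)"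
    and t_unit_law:
      "\<lbrakk>X \<in> Obj C; Y \<in> Obj C; f \<in> Ob (Hom D (PObj J X) (TOb T Y))\<rbrakk>
      \<Longrightarrow> RUnit D (TOb T X) (TOb T Y) (onOb (Ext T X Y) f)
            \<cdot>\<^bsub>Hom D (TOb T X) (TOb T Y)\<^esub>
              lwhisk D (TOb T X) (TOb T X) (TOb T Y) (onOb (Ext T X Y) f) (Theta T X)
            \<cdot>\<^bsub>Hom D (TOb T X) (TOb T Y)\<^esub> Mu T X X Y (f, TUnit T X)
            \<cdot>\<^bsub>Hom D (TOb T X) (TOb T Y)\<^esub> onAr (Ext T X Y) (Eta T X Y f)
          = Idn (Hom D (TOb T X) (TOb T Y)) (onOb (Ext T X Y) f)"

definition kleisli_bicat ::
  "('co, 'cm, 'cc) bicat_data \<Rightarrow> ('o, 'm, 'c) bicat_data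
    \<Rightarrow> ('co, 'cm, 'cc, 'o, 'm, 'c) pseudofunctor_data
    \<Rightarrow> ('co, 'o, 'm, 'c) rel_pseudomonad_data \<Rightarrow> ('co, 'm, 'c) bicat_data"
  where "kleisli_bicat C D J T =
    \<lparr>Obj = Obj C,
     Hom = (\<lambda>X Y. Hom D (PObj J X) (TOb T Y)),
     HComp = kl_hcomp D J T,
     One = TUnit T,
     Assoc = (\<lambda>X Y Z W (h, g, f).
       Assoc D (PObj J X) (TOb T Y) (TOb T Z) (TOb T W)
           (onOb (Ext T Z W) h, onOb (Ext T Y Z) g, f)
       \<cdot>\<^bsub>Hom D (PObj J X) (TOb T W)\<^esub>
         rwhisk D (PObj J X) (TOb T Y) (TOb T W) (Mu T Y Z W (h, g)) f),
     LUnit = (\<lambda>X Y f.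
       LUnit D (PObj J X) (TOb T Y) f
       \<cdot>\<^bsub>Hom D (PObj J X) (TOb T Y)\<^esub>
         rwhisk D (PObj J X) (TOb T Y) (TOb T Y) (Theta T Y) f),
     RUnit = (\<lambda>X Y f. inv_of (Hom D (PObj J X) (TOb T Y)) (Eta T X Y f))\<rparr>"

definition kleisli_pseudofunctor ::
  "('co, 'o, 'm, 'c) rel_pseudomonad_data \<Rightarrow> ('co, 'm, 'c, 'o, 'm, 'c) pseudofunctor_data"
  where "kleisli_pseudofunctor T =
    \<lparr>PObj = TOb T, PHom = Ext T, PComp = Mu T, PUnit = Theta T\<rparr>"

section \<open>Relative left pseudoadjoints\<close>

text \<open>
  \<open>Sharp F X A\<close> is the left adjoint \<open>D[JX, GA] \<rightarrow> E[FX, A]\<close>; \<open>AUnit F X A\<close> and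
  \<open>ACounit F X A\<close> are the unit and counit of the adjoint equivalence.
\<close>

record ('co, 'eo, 'em, 'ec, 'm, 'c) rel_pseudoadjoint_data =
  FOb :: "'co \<Rightarrow> 'eo"
  FUnit :: "'co \<Rightarrow> 'm"
  Sharp :: "'co \<Rightarrow> 'eo \<Rightarrow> ('m, 'c, 'em, 'ec) functor_data"
  AUnit :: "'co \<Rightarrow> 'eo \<Rightarrow> 'm \<Rightarrow> 'c"
  ACounit :: "'co \<Rightarrow> 'eo \<Rightarrow> 'em \<Rightarrow> 'ec"

locale relative_left_pseudoadjoint = J: pseudofunctor C D J + G: pseudofunctor E D G
  for C :: "('co, 'cm, 'cc) bicat_data" and D :: "('o, 'm, 'c) bicat_data"
    and E :: "('eo, 'em, 'ec) bicat_data"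
    and J :: "('co, 'cm, 'cc, 'o, 'm, 'c) pseudofunctor_data"
    and G :: "('eo, 'em, 'ec, 'o, 'm, 'c) pseudofunctor_data" +
  fixes F :: "('co, 'eo, 'em, 'ec, 'm, 'c) rel_pseudoadjoint_data"
  assumes f_obj: "X \<in> Obj C \<Longrightarrow> FOb F X \<in> Obj E"
    and f_unit: "X \<in> Obj C \<Longrightarrow> FUnit F X \<in> Ob (Hom D (PObj J X) (PObj G (FOb F X)))"
    and hom_adjoint_equivalence: "\<lbrakk>X \<in> Obj C; A \<in> Obj E\<rbrakk>
      \<Longrightarrow> adjoint_equivalence (Hom D (PObj J X) (PObj G A)) (Hom E (FOb F X) A)
            (Sharp F X A)
            (precomp_functor D (PObj J X) (PObj G (FOb F X)) (PObj G A) (FUnit F X)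
              \<circ>\<^sub>F PHom G (FOb F X) A)
            (AUnit F X A) (ACounit F X A)"

end

theory Submission
  imports Defs
begin

text \<open>
  The hom-categories \<open>D[JX, TA]\<close> and \<open>Kl(T)[X, A]\<close> coincide, so the left adjoint can be taken to be
  the identity. Its right adjoint \<open>(-)* i_X\<close> is isomorphic to the identity by \<open>\<eta>\<close>, which serves as
  the unit, with counit \<open>\<eta>\<inverse>\<close>; the triangle identities hold because naturality of \<open>\<eta>\<close> at its own
  invertible components gives \<open>\<eta>_{f* i} = (\<eta>_f)* i\<close>. The work lies in \<open>Kl(T)\<close> and \<open>G\<^sup>T\<close>: the
  pentagon is the associativity axiom whiskered with a 1-cell, the triangle is the unit axiom
  whiskered with a 1-cell, and the left unit coherence of \<open>G\<^sup>T\<close> follows from these two axioms.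
\<close>

section \<open>Categories, functors, natural isomorphisms\<close>

text \<open>The informal axioms suppress the associators and unitors of D. Here they are explicit,
  so every coherence law of Kl also consumes the matching law of D: its pentagon for the pentagon,
  its triangle for the triangle, and naturality of its associator to move the cells \<mu> and
  \<theta> across. The whiskered unit axiom is needed with source JX for the triangle of Kl, and
  with both JX and TX for the left unit coherence; hence it is proved for 1-cells out of an
  arbitrary object of D. A second obstacle is circularity: naturality of the structural cells of Kl
  is stated with composition in Kl, before Kl is known to be a bicategory. The calculus of
  composition is therefore developed from functoriality of composition alone. The pseudoadjoint
  itself is the identity on objects, since Kl has the objects of C, and its universal 1-cells are
  the units of T.\<close>

context category
begin

text \<open>The axioms carry source and target as parameters of \<open>in_hom\<close> that do not
  all occur in the conclusions. With \<open>Dom\<close> and \<open>Cod\<close> in the premises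
  instead, the rules become conditional rewrite rules whose side conditions the simplifier can
  compute.\<close>

lemma comp_arr: "\<lbrakk>f \<in> Ar C; g \<in> Ar C; Dom C g = Cod C f\<rbrakk> \<Longrightarrow> g \<cdot>\<^bsub>C\<^esub> f \<in> Ar C"
  and dom_comp: "\<lbrakk>f \<in> Ar C; g \<in> Ar C; Dom C g = Cod C f\<rbrakk> \<Longrightarrow> Dom C (g \<cdot>\<^bsub>C\<^esub> f) = Dom C f"
  and cod_comp: "\<lbrakk>f \<in> Ar C; g \<in> Ar C; Dom C g = Cod C f\<rbrakk> \<Longrightarrow> Cod C (g \<cdot>\<^bsub>C\<^esub> f) = Cod C g"
  using comp_in_hom[of f "Dom C f" "Cod C f" g "Cod C g"] by (auto simp: in_hom_def)

lemma id_arr: "a \<in> Ob C \<Longrightarrow> Idn C a \<in> Ar C"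
  and dom_id: "a \<in> Ob C \<Longrightarrow> Dom C (Idn C a) = a"
  and cod_id: "a \<in> Ob C \<Longrightarrow> Cod C (Idn C a) = a"
  using id_in_hom[of a] by (auto simp: in_hom_def)

lemma comp_id_arr: "\<lbrakk>f \<in> Ar C; Dom C f = a\<rbrakk> \<Longrightarrow> f \<cdot>\<^bsub>C\<^esub> Idn C a = f"
  and id_comp_arr: "\<lbrakk>f \<in> Ar C; Cod C f = a\<rbrakk> \<Longrightarrow> Idn C a \<cdot>\<^bsub>C\<^esub> f = f"
  using comp_id[of f "Dom C f" "Cod C f"] id_comp[of f "Dom C f" "Cod C f"]
  by (auto simp: in_hom_def)

lemma comp_assoc_arr:
  "\<lbrakk>f \<in> Ar C; g \<in> Ar C; h \<in> Ar C; Dom C g = Cod C f; Dom C h = Cod C g\<rbrakk>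
    \<Longrightarrow> (h \<cdot>\<^bsub>C\<^esub> g) \<cdot>\<^bsub>C\<^esub> f = h \<cdot>\<^bsub>C\<^esub> (g \<cdot>\<^bsub>C\<^esub> f)"
  by (rule comp_assoc) (auto simp: in_hom_def)

lemma inverse_arrows_sym: "inverse_arrows C f g \<Longrightarrow> inverse_arrows C g f"
  by (auto simp: inverse_arrows_def in_hom_def)

lemma inverse_arrows_unique:
  assumes "inverse_arrows C f g" "inverse_arrows C f g'"
  shows "g = g'"
proof -
  have "g = (g' \<cdot>\<^bsub>C\<^esub> f) \<cdot>\<^bsub>C\<^esub> g"
    using assms by (simp add: inverse_arrows_def in_hom_def id_comp_arr)
  also have "\<dots> = g' \<cdot>\<^bsub>C\<^esub> (f \<cdot>\<^bsub>C\<^esub> g)"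
    using assms by (intro comp_assoc_arr) (auto simp: inverse_arrows_def in_hom_def)
  also have "\<dots> = g'"
    using assms by (simp add: inverse_arrows_def in_hom_def comp_id_arr)
  finally show ?thesis .
qed

lemma inverse_arrows_inv_of: "iso C f \<Longrightarrow> inverse_arrows C f (inv_of C f)"
  unfolding iso_def inv_of_def by (metis inverse_arrows_unique theI)

lemma inv_of_eqI: "inverse_arrows C f g \<Longrightarrow> inv_of C f = g"
  using inverse_arrows_inv_of inverse_arrows_unique unfolding iso_def by blast

lemma iso_arr: "iso C f \<Longrightarrow> f \<in> Ar C"
  by (auto simp: iso_def inverse_arrows_def in_hom_def)

lemma inv_of_arr: "iso C f \<Longrightarrow> inv_of C f \<in> Ar C"
  and dom_inv_of: "iso C f \<Longrightarrow> Dom C (inv_of C f) = Cod C f"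
  and cod_inv_of: "iso C f \<Longrightarrow> Cod C (inv_of C f) = Dom C f"
  and inv_of_comp: "iso C f \<Longrightarrow> inv_of C f \<cdot>\<^bsub>C\<^esub> f = Idn C (Dom C f)"
  and comp_inv_of: "iso C f \<Longrightarrow> f \<cdot>\<^bsub>C\<^esub> inv_of C f = Idn C (Cod C f)"
  and iso_inv_of: "iso C f \<Longrightarrow> iso C (inv_of C f)"
  using inverse_arrows_inv_of[of f] inverse_arrows_sym[of f "inv_of C f"]
  by (auto simp: iso_def inverse_arrows_def in_hom_def)

lemma iso_comp:
  assumes "iso C f" "iso C g" "Dom C g = Cod C f"
  shows "iso C (g \<cdot>\<^bsub>C\<^esub> f)"
proof -
  note s = comp_arr dom_comp cod_comp comp_assoc_arr inv_of_arr dom_inv_of cod_inv_of iso_arr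
    inv_of_comp comp_inv_of id_comp_arr comp_id_arr
  \<comment> \<open>The inverse law is removed so that the right-hand side is only rebracketed and
    not cancelled; the cancellation happens where this equation is used.\<close>
  have "inv_of C f \<cdot>\<^bsub>C\<^esub> (inv_of C g \<cdot>\<^bsub>C\<^esub> (g \<cdot>\<^bsub>C\<^esub> f))
      = inv_of C f \<cdot>\<^bsub>C\<^esub> ((inv_of C g \<cdot>\<^bsub>C\<^esub> g) \<cdot>\<^bsub>C\<^esub> f)"
    using assms by (simp add: s del: inv_of_comp)
  moreover have "g \<cdot>\<^bsub>C\<^esub> (f \<cdot>\<^bsub>C\<^esub> (inv_of C f \<cdot>\<^bsub>C\<^esub> inv_of C g))
      = g \<cdot>\<^bsub>C\<^esub> ((f \<cdot>\<^bsub>C\<^esub> inv_of C f) \<cdot>\<^bsub>C\<^esub> inv_of C g)"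
    using assms by (simp add: s del: comp_inv_of)
  ultimately have "inverse_arrows C (g \<cdot>\<^bsub>C\<^esub> f) (inv_of C f \<cdot>\<^bsub>C\<^esub> inv_of C g)"
    using assms by (simp add: inverse_arrows_def in_hom_def s)
  then show ?thesis
    unfolding iso_def by blast
qed

lemma iso_cancel_right:
  assumes "iso C e" "f \<in> Ar C" "g \<in> Ar C" "Dom C f = Cod C e" "Dom C g = Cod C e"
    and eq: "f \<cdot>\<^bsub>C\<^esub> e = g \<cdot>\<^bsub>C\<^esub> e"
  shows "f = g"
proof -
  have "(x \<cdot>\<^bsub>C\<^esub> e) \<cdot>\<^bsub>C\<^esub> inv_of C e = x" if "x \<in> Ar C" "Dom C x = Cod C e" for x
    using that assms(1) comp_assoc_arr[of "inv_of C e" e x]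
    by (simp add: iso_arr inv_of_arr dom_inv_of cod_inv_of comp_inv_of comp_id_arr)
  then show ?thesis
    using assms by metis
qed

end

lemmas cat_simps = category.dom_ob category.cod_ob category.comp_arr category.dom_comp
  category.cod_comp category.id_arr category.dom_id category.cod_id category.comp_id_arr
  category.id_comp_arr

section \<open>Functors and products of categories\<close>

context cat_functor
begin

lemma on_arr: "f \<in> Ar C \<Longrightarrow> onAr F f \<in> Ar D"
  and dom_on_arr: "f \<in> Ar C \<Longrightarrow> Dom D (onAr F f) = onOb F (Dom C f)"
  and cod_on_arr: "f \<in> Ar C \<Longrightarrow> Cod D (onAr F f) = onOb F (Cod C f)"
  using ar[of f "Dom C f" "Cod C f"] by (auto simp: in_hom_def)

lemma pres_comp_arr:
  "\<lbrakk>f \<in> Ar C; g \<in> Ar C; Dom C g = Cod C f\<rbrakk>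
    \<Longrightarrow> onAr F (g \<cdot>\<^bsub>C\<^esub> f) = onAr F g \<cdot>\<^bsub>D\<^esub> onAr F f"
  by (rule pres_comp) (auto simp: in_hom_def)

lemma pres_inverse_arrows:
  assumes "inverse_arrows C f g"
  shows "inverse_arrows D (onAr F f) (onAr F g)"
proof -
  have "onAr F (g \<cdot>\<^bsub>C\<^esub> f) = onAr F (Idn C (Dom C f))"
    "onAr F (f \<cdot>\<^bsub>C\<^esub> g) = onAr F (Idn C (Cod C f))"
    using assms by (auto simp: inverse_arrows_def)
  then show ?thesis
    using assms by (simp add: inverse_arrows_def in_hom_def on_arr dom_on_arr cod_on_arr
        pres_id dom.dom_ob dom.cod_ob flip: pres_comp_arr)
qed

lemma pres_iso: "iso C f \<Longrightarrow> iso D (onAr F f)"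
  using pres_inverse_arrows unfolding iso_def by blast

lemma pres_inv_of: "iso C f \<Longrightarrow> onAr F (inv_of C f) = inv_of D (onAr F f)"
  using cod.inv_of_eqI dom.inverse_arrows_inv_of pres_inverse_arrows by metis

end

lemma cat_functor_arrI:
  assumes "category C" "category D"
    and "\<And>a. a \<in> Ob C \<Longrightarrow> onOb F a \<in> Ob D"
    and "\<And>f. f \<in> Ar C \<Longrightarrow> onAr F f \<in> Ar D"
    and "\<And>f. f \<in> Ar C \<Longrightarrow> Dom D (onAr F f) = onOb F (Dom C f)"
    and "\<And>f. f \<in> Ar C \<Longrightarrow> Cod D (onAr F f) = onOb F (Cod C f)"
    and "\<And>a. a \<in> Ob C \<Longrightarrow> onAr F (Idn C a) = Idn D (onOb F a)"
    and "\<And>f g. \<lbrakk>f \<in> Ar C; g \<in> Ar C; Dom C g = Cod C f\<rbrakk>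
      \<Longrightarrow> onAr F (g \<cdot>\<^bsub>C\<^esub> f) = onAr F g \<cdot>\<^bsub>D\<^esub> onAr F f"
  shows "cat_functor C D F"
  using assms by (auto simp: cat_functor_def cat_functor_axioms_def in_hom_def)

lemma cat_functor_id: "category C \<Longrightarrow> cat_functor C C id_functor"
  by (auto intro!: cat_functor_arrI simp: id_functor_def)

lemma cat_functor_comp:
  assumes "cat_functor C D F" "cat_functor D E G"
  shows "cat_functor C E (G \<circ>\<^sub>F F)"
proof -
  interpret F: cat_functor C D F by fact
  interpret G: cat_functor D E G by fact
  show ?thesis
    by (rule cat_functor_arrI)
      (auto simp: comp_functor_def F.dom.category_axioms G.cod.category_axioms F.ob G.ob
        F.on_arr G.on_arr F.dom_on_arr G.dom_on_arr F.cod_on_arr G.cod_on_arr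
        F.pres_id G.pres_id F.pres_comp_arr G.pres_comp_arr)
qed

lemma prod_cat_simps:
  "Ob (C \<times>\<^sub>C D) = Ob C \<times> Ob D" "Ar (C \<times>\<^sub>C D) = Ar C \<times> Ar D"
  "Dom (C \<times>\<^sub>C D) = map_prod (Dom C) (Dom D)" "Cod (C \<times>\<^sub>C D) = map_prod (Cod C) (Cod D)"
  "Idn (C \<times>\<^sub>C D) = map_prod (Idn C) (Idn D)"
  "(g, g') \<cdot>\<^bsub>C \<times>\<^sub>C D\<^esub> (f, f') = (g \<cdot>\<^bsub>C\<^esub> f, g' \<cdot>\<^bsub>D\<^esub> f')"
  by (simp_all add: prod_cat_def)

lemma category_arrI:
  assumes "\<And>f. f \<in> Ar C \<Longrightarrow> Dom C f \<in> Ob C" "\<And>f. f \<in> Ar C \<Longrightarrow> Cod C f \<in> Ob C"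
    and "\<And>a. a \<in> Ob C \<Longrightarrow> Idn C a \<in> Ar C \<and> Dom C (Idn C a) = a \<and> Cod C (Idn C a) = a"
    and "\<And>f g. \<lbrakk>f \<in> Ar C; g \<in> Ar C; Dom C g = Cod C f\<rbrakk>
      \<Longrightarrow> g \<cdot>\<^bsub>C\<^esub> f \<in> Ar C \<and> Dom C (g \<cdot>\<^bsub>C\<^esub> f) = Dom C f \<and> Cod C (g \<cdot>\<^bsub>C\<^esub> f) = Cod C g"
    and "\<And>f. f \<in> Ar C \<Longrightarrow> f \<cdot>\<^bsub>C\<^esub> Idn C (Dom C f) = f"
    and "\<And>f. f \<in> Ar C \<Longrightarrow> Idn C (Cod C f) \<cdot>\<^bsub>C\<^esub> f = f"
    and "\<And>f g h. \<lbrakk>f \<in> Ar C; g \<in> Ar C; h \<in> Ar C; Dom C g = Cod C f; Dom C h = Cod C g\<rbrakk>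
      \<Longrightarrow> (h \<cdot>\<^bsub>C\<^esub> g) \<cdot>\<^bsub>C\<^esub> f = h \<cdot>\<^bsub>C\<^esub> (g \<cdot>\<^bsub>C\<^esub> f)"
  shows "category C"
  using assms by unfold_locales (auto simp: in_hom_def)

lemma category_prod:
  assumes "category C" "category D"
  shows "category (C \<times>\<^sub>C D)"
proof -
  interpret C: category C by fact
  interpret D: category D by fact
  show ?thesis
    by (rule category_arrI)
      (auto simp: prod_cat_simps C.dom_ob D.dom_ob C.cod_ob D.cod_ob C.id_arr D.id_arr
        C.dom_id D.dom_id C.cod_id D.cod_id C.comp_arr D.comp_arr C.dom_comp D.dom_comp
        C.cod_comp D.cod_comp C.comp_id_arr D.comp_id_arr C.id_comp_arr D.id_comp_arr
        C.comp_assoc_arr D.comp_assoc_arr)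
qed

lemma iso_prod: "\<lbrakk>iso C f; iso D g\<rbrakk> \<Longrightarrow> iso (C \<times>\<^sub>C D) (f, g)"
  unfolding iso_def inverse_arrows_def in_hom_def
  by (auto simp: prod_cat_simps)

lemma cat_functor_prod:
  assumes "cat_functor C D F" "cat_functor C' D' F'"
  shows "cat_functor (C \<times>\<^sub>C C') (D \<times>\<^sub>C D') (F \<times>\<^sub>F F')"
proof -
  interpret F: cat_functor C D F by fact
  interpret F': cat_functor C' D' F' by fact
  show ?thesis
    by (rule cat_functor_arrI)
      (auto simp: prod_functor_def prod_cat_simps category_prod
        F.dom.category_axioms F'.dom.category_axioms F.cod.category_axioms F'.cod.category_axioms
        F.ob F'.ob F.on_arr F'.on_arr F.dom_on_arr F'.dom_on_arr F.cod_on_arr F'.cod_on_arr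
        F.pres_id F'.pres_id F.pres_comp_arr F'.pres_comp_arr)
qed

section \<open>Natural isomorphisms and their inverses\<close>

lemma natural_iso_arrI:
  assumes "cat_functor C D F" "cat_functor C D G"
    and "\<And>a. a \<in> Ob C \<Longrightarrow> iso D (t a)"
    and "\<And>a. a \<in> Ob C \<Longrightarrow> Dom D (t a) = onOb F a"
    and "\<And>a. a \<in> Ob C \<Longrightarrow> Cod D (t a) = onOb G a"
    and "\<And>f. f \<in> Ar C \<Longrightarrow> t (Cod C f) \<cdot>\<^bsub>D\<^esub> onAr F f = onAr G f \<cdot>\<^bsub>D\<^esub> t (Dom C f)"
  shows "natural_iso C D F G t"
proof -
  interpret F: cat_functor C D F by fact
  interpret G: cat_functor C D G by fact
  show ?thesis
    using assms by unfold_locales (auto simp: in_hom_def F.cod.iso_arr)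
qed

context natural_iso
begin

lemma component_arr: "a \<in> Ob C \<Longrightarrow> t a \<in> Ar D"
  and dom_component: "a \<in> Ob C \<Longrightarrow> Dom D (t a) = onOb F a"
  and cod_component: "a \<in> Ob C \<Longrightarrow> Cod D (t a) = onOb G a"
  using component[of a] by (auto simp: in_hom_def)

lemma natural_arr: "f \<in> Ar C \<Longrightarrow> t (Cod C f) \<cdot>\<^bsub>D\<^esub> onAr F f = onAr G f \<cdot>\<^bsub>D\<^esub> t (Dom C f)"
  by (rule natural) (auto simp: in_hom_def)

text \<open>The naturality square is conjugated with the inverse components. Applied to
  \<open>Eta\<close>, this supplies both the right unit of Kl and the counit of the adjoint
  equivalences.\<close>

lemma natural_iso_inv: "natural_iso C D G F (\<lambda>a. inv_of D (t a))"
proof (rule natural_iso_arrI)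
  fix f assume f: "f \<in> Ar C"
  let ?a = "Dom C f" and ?b = "Cod C f"
  have ob: "?a \<in> Ob C" "?b \<in> Ob C"
    using f F.dom.dom_ob F.dom.cod_ob by auto
  note s = f ob component_arr component_iso dom_component cod_component F.on_arr G.on_arr
    F.dom_on_arr G.dom_on_arr F.cod_on_arr G.cod_on_arr F.cod.comp_arr F.cod.dom_comp
    F.cod.cod_comp F.cod.comp_assoc_arr F.cod.inv_of_arr F.cod.dom_inv_of F.cod.cod_inv_of
    F.cod.comp_id_arr F.cod.id_comp_arr
  have "inv_of D (t ?b) \<cdot>\<^bsub>D\<^esub> onAr G f
      = inv_of D (t ?b) \<cdot>\<^bsub>D\<^esub> ((onAr G f \<cdot>\<^bsub>D\<^esub> t ?a) \<cdot>\<^bsub>D\<^esub> inv_of D (t ?a))"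
    by (simp add: s F.cod.comp_inv_of)
  also have "\<dots> = inv_of D (t ?b) \<cdot>\<^bsub>D\<^esub> ((t ?b \<cdot>\<^bsub>D\<^esub> onAr F f) \<cdot>\<^bsub>D\<^esub> inv_of D (t ?a))"
    by (simp only: natural_arr[OF f])
  also have "\<dots> = (inv_of D (t ?b) \<cdot>\<^bsub>D\<^esub> t ?b) \<cdot>\<^bsub>D\<^esub> (onAr F f \<cdot>\<^bsub>D\<^esub> inv_of D (t ?a))"
    by (simp add: s)
  also have "\<dots> = onAr F f \<cdot>\<^bsub>D\<^esub> inv_of D (t ?a)"
    by (simp add: s F.cod.inv_of_comp)
  finally show "inv_of D (t ?b) \<cdot>\<^bsub>D\<^esub> onAr G f = onAr F f \<cdot>\<^bsub>D\<^esub> inv_of D (t ?a)" .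
qed (auto simp: component_iso F.cod.iso_inv_of F.cod.dom_inv_of F.cod.cod_inv_of dom_component
    cod_component F.cat_functor_axioms G.cat_functor_axioms)

end

section \<open>Bicategories\<close>

text \<open>The part of a bicategory that precedes the coherence cells, enough for interchange and
  whiskering. \<open>Kl\<close> is an instance before its coherence laws are proved, so the lemmas
  below apply to it as well as to any \<open>bicategory\<close>.\<close>

locale prebicategory =
  fixes B :: "('o, 'm, 'c) bicat_data"
  assumes category_hom: "\<lbrakk>X \<in> Obj B; Y \<in> Obj B\<rbrakk> \<Longrightarrow> category (Hom B X Y)"
    and functor_hcomp: "\<lbrakk>X \<in> Obj B; Y \<in> Obj B; Z \<in> Obj B\<rbrakk>
      \<Longrightarrow> cat_functor (Hom B Y Z \<times>\<^sub>C Hom B X Y) (Hom B X Z) (HComp B X Y Z)"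
    and one_ob: "X \<in> Obj B \<Longrightarrow> One B X \<in> Ob (Hom B X X)"
begin

lemmas hom_simps = cat_simps[OF category_hom]

lemma comp1_ob:
  "\<lbrakk>X \<in> Obj B; Y \<in> Obj B; Z \<in> Obj B; g \<in> Ob (Hom B Y Z); f \<in> Ob (Hom B X Y)\<rbrakk>
    \<Longrightarrow> comp1 B X Y Z g f \<in> Ob (Hom B X Z)"
  using cat_functor.ob[OF functor_hcomp, of X Y Z "(g, f)"]
  by (simp add: comp1_def prod_cat_simps)

lemma
  assumes "X \<in> Obj B" "Y \<in> Obj B" "Z \<in> Obj B" "\<beta> \<in> Ar (Hom B Y Z)" "\<alpha> \<in> Ar (Hom B X Y)"
  shows comp2_arr: "comp2 B X Y Z \<beta> \<alpha> \<in> Ar (Hom B X Z)"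
    and dom_comp2: "Dom (Hom B X Z) (comp2 B X Y Z \<beta> \<alpha>)
      = comp1 B X Y Z (Dom (Hom B Y Z) \<beta>) (Dom (Hom B X Y) \<alpha>)"
    and cod_comp2: "Cod (Hom B X Z) (comp2 B X Y Z \<beta> \<alpha>)
      = comp1 B X Y Z (Cod (Hom B Y Z) \<beta>) (Cod (Hom B X Y) \<alpha>)"
  using assms cat_functor.on_arr[OF functor_hcomp, of X Y Z "(\<beta>, \<alpha>)"]
    cat_functor.dom_on_arr[OF functor_hcomp, of X Y Z "(\<beta>, \<alpha>)"]
    cat_functor.cod_on_arr[OF functor_hcomp, of X Y Z "(\<beta>, \<alpha>)"]
  by (simp_all add: comp1_def comp2_def prod_cat_simps)

lemma comp2_id:
  "\<lbrakk>X \<in> Obj B; Y \<in> Obj B; Z \<in> Obj B; g \<in> Ob (Hom B Y Z); f \<in> Ob (Hom B X Y)\<rbrakk>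
    \<Longrightarrow> comp2 B X Y Z (Idn (Hom B Y Z) g) (Idn (Hom B X Y) f)
      = Idn (Hom B X Z) (comp1 B X Y Z g f)"
  using cat_functor.pres_id[OF functor_hcomp, of X Y Z "(g, f)"]
  by (simp add: comp1_def comp2_def prod_cat_simps)

lemma interchange:
  "\<lbrakk>X \<in> Obj B; Y \<in> Obj B; Z \<in> Obj B; \<beta> \<in> Ar (Hom B Y Z); \<beta>' \<in> Ar (Hom B Y Z);
    \<alpha> \<in> Ar (Hom B X Y); \<alpha>' \<in> Ar (Hom B X Y);
    Dom (Hom B Y Z) \<beta>' = Cod (Hom B Y Z) \<beta>; Dom (Hom B X Y) \<alpha>' = Cod (Hom B X Y) \<alpha>\<rbrakk>
    \<Longrightarrow> comp2 B X Y Z (\<beta>' \<cdot>\<^bsub>Hom B Y Z\<^esub> \<beta>) (\<alpha>' \<cdot>\<^bsub>Hom B X Y\<^esub> \<alpha>)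
      = comp2 B X Y Z \<beta>' \<alpha>' \<cdot>\<^bsub>Hom B X Z\<^esub> comp2 B X Y Z \<beta> \<alpha>"
  using cat_functor.pres_comp_arr[OF functor_hcomp, of X Y Z "(\<beta>, \<alpha>)" "(\<beta>', \<alpha>')"]
  by (simp add: comp2_def prod_cat_simps)

lemma iso_comp2:
  "\<lbrakk>X \<in> Obj B; Y \<in> Obj B; Z \<in> Obj B; iso (Hom B Y Z) \<beta>; iso (Hom B X Y) \<alpha>\<rbrakk>
    \<Longrightarrow> iso (Hom B X Z) (comp2 B X Y Z \<beta> \<alpha>)"
  using cat_functor.pres_iso[OF functor_hcomp, of X Y Z "(\<beta>, \<alpha>)"]
  by (simp add: comp2_def iso_prod)

lemma iso_id: "\<lbrakk>X \<in> Obj B; Y \<in> Obj B; f \<in> Ob (Hom B X Y)\<rbrakk> \<Longrightarrow> iso (Hom B X Y) (Idn (Hom B X Y) f)"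
  unfolding iso_def by (rule exI[of _ "Idn (Hom B X Y) f"])
    (simp add: inverse_arrows_def in_hom_def hom_simps)

lemma
  assumes "X \<in> Obj B" "Y \<in> Obj B" "Z \<in> Obj B" "g \<in> Ob (Hom B Y Z)" "\<alpha> \<in> Ar (Hom B X Y)"
  shows lwhisk_arr: "lwhisk B X Y Z g \<alpha> \<in> Ar (Hom B X Z)"
    and dom_lwhisk: "Dom (Hom B X Z) (lwhisk B X Y Z g \<alpha>) = comp1 B X Y Z g (Dom (Hom B X Y) \<alpha>)"
    and cod_lwhisk: "Cod (Hom B X Z) (lwhisk B X Y Z g \<alpha>) = comp1 B X Y Z g (Cod (Hom B X Y) \<alpha>)"
  using assms by (simp_all add: lwhisk_def comp2_arr dom_comp2 cod_comp2 hom_simps)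

lemma
  assumes "X \<in> Obj B" "Y \<in> Obj B" "Z \<in> Obj B" "\<beta> \<in> Ar (Hom B Y Z)" "f \<in> Ob (Hom B X Y)"
  shows rwhisk_arr: "rwhisk B X Y Z \<beta> f \<in> Ar (Hom B X Z)"
    and dom_rwhisk: "Dom (Hom B X Z) (rwhisk B X Y Z \<beta> f) = comp1 B X Y Z (Dom (Hom B Y Z) \<beta>) f"
    and cod_rwhisk: "Cod (Hom B X Z) (rwhisk B X Y Z \<beta> f) = comp1 B X Y Z (Cod (Hom B Y Z) \<beta>) f"
  using assms by (simp_all add: rwhisk_def comp2_arr dom_comp2 cod_comp2 hom_simps)

lemma lwhisk_id:
  "\<lbrakk>X \<in> Obj B; Y \<in> Obj B; Z \<in> Obj B; g \<in> Ob (Hom B Y Z); f \<in> Ob (Hom B X Y)\<rbrakk>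
    \<Longrightarrow> lwhisk B X Y Z g (Idn (Hom B X Y) f) = Idn (Hom B X Z) (comp1 B X Y Z g f)"
  by (simp add: lwhisk_def comp2_id)

lemma lwhisk_comp:
  assumes "X \<in> Obj B" "Y \<in> Obj B" "Z \<in> Obj B" "g \<in> Ob (Hom B Y Z)" "\<alpha> \<in> Ar (Hom B X Y)"
    "\<alpha>' \<in> Ar (Hom B X Y)" "Dom (Hom B X Y) \<alpha>' = Cod (Hom B X Y) \<alpha>"
  shows "lwhisk B X Y Z g (\<alpha>' \<cdot>\<^bsub>Hom B X Y\<^esub> \<alpha>)
    = lwhisk B X Y Z g \<alpha>' \<cdot>\<^bsub>Hom B X Z\<^esub> lwhisk B X Y Z g \<alpha>"
  using assms interchange[of X Y Z "Idn (Hom B Y Z) g" "Idn (Hom B Y Z) g" \<alpha> \<alpha>']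
  by (simp add: lwhisk_def hom_simps)

lemma rwhisk_comp:
  assumes "X \<in> Obj B" "Y \<in> Obj B" "Z \<in> Obj B" "f \<in> Ob (Hom B X Y)" "\<beta> \<in> Ar (Hom B Y Z)"
    "\<beta>' \<in> Ar (Hom B Y Z)" "Dom (Hom B Y Z) \<beta>' = Cod (Hom B Y Z) \<beta>"
  shows "rwhisk B X Y Z (\<beta>' \<cdot>\<^bsub>Hom B Y Z\<^esub> \<beta>) f
    = rwhisk B X Y Z \<beta>' f \<cdot>\<^bsub>Hom B X Z\<^esub> rwhisk B X Y Z \<beta> f"
  using assms interchange[of X Y Z \<beta> \<beta>' "Idn (Hom B X Y) f" "Idn (Hom B X Y) f"]
  by (simp add: rwhisk_def hom_simps)

text \<open>Both sides equal \<open>comp2 B X Y Z \<beta> \<alpha>\<close>, by interchange with an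
  identity in each factor.\<close>

lemma whisk_exchange:
  assumes "X \<in> Obj B" "Y \<in> Obj B" "Z \<in> Obj B" "\<beta> \<in> Ar (Hom B Y Z)" "\<alpha> \<in> Ar (Hom B X Y)"
  shows "lwhisk B X Y Z (Cod (Hom B Y Z) \<beta>) \<alpha> \<cdot>\<^bsub>Hom B X Z\<^esub> rwhisk B X Y Z \<beta> (Dom (Hom B X Y) \<alpha>)
    = rwhisk B X Y Z \<beta> (Cod (Hom B X Y) \<alpha>) \<cdot>\<^bsub>Hom B X Z\<^esub> lwhisk B X Y Z (Dom (Hom B Y Z) \<beta>) \<alpha>"
  using assms interchange[of X Y Z \<beta> "Idn (Hom B Y Z) (Cod (Hom B Y Z) \<beta>)"
      "Idn (Hom B X Y) (Dom (Hom B X Y) \<alpha>)" \<alpha>]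
    interchange[of X Y Z "Idn (Hom B Y Z) (Dom (Hom B Y Z) \<beta>)" \<beta> \<alpha>
      "Idn (Hom B X Y) (Cod (Hom B X Y) \<alpha>)"]
  by (simp add: lwhisk_def rwhisk_def hom_simps)

text \<open>Interchange against an identity in the right-hand factor. It lets a whiskered \<mu> be
  absorbed into a horizontal composite in the naturality square for the associator of Kl.\<close>

lemma comp2_rwhisk_comp:
  assumes "X \<in> Obj B" "Y \<in> Obj B" "Z \<in> Obj B" "\<alpha> \<in> Ar (Hom B X Y)" "\<beta> \<in> Ar (Hom B Y Z)"
    "\<beta>' \<in> Ar (Hom B Y Z)" "Dom (Hom B Y Z) \<beta>' = Cod (Hom B Y Z) \<beta>"
  shows "rwhisk B X Y Z \<beta>' (Cod (Hom B X Y) \<alpha>) \<cdot>\<^bsub>Hom B X Z\<^esub> comp2 B X Y Z \<beta> \<alpha>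
      = comp2 B X Y Z (\<beta>' \<cdot>\<^bsub>Hom B Y Z\<^esub> \<beta>) \<alpha>"
    and "comp2 B X Y Z \<beta>' \<alpha> \<cdot>\<^bsub>Hom B X Z\<^esub> rwhisk B X Y Z \<beta> (Dom (Hom B X Y) \<alpha>)
      = comp2 B X Y Z (\<beta>' \<cdot>\<^bsub>Hom B Y Z\<^esub> \<beta>) \<alpha>"
  using assms interchange[of X Y Z \<beta> \<beta>' \<alpha> "Idn (Hom B X Y) (Cod (Hom B X Y) \<alpha>)"]
    interchange[of X Y Z \<beta> \<beta>' "Idn (Hom B X Y) (Dom (Hom B X Y) \<alpha>)" \<alpha>]
  by (simp_all add: rwhisk_def hom_simps)

lemma iso_rwhisk:
  "\<lbrakk>X \<in> Obj B; Y \<in> Obj B; Z \<in> Obj B; f \<in> Ob (Hom B X Y); iso (Hom B Y Z) \<beta>\<rbrakk>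
    \<Longrightarrow> iso (Hom B X Z) (rwhisk B X Y Z \<beta> f)"
  by (simp add: rwhisk_def iso_comp2 iso_id)

lemmas cell_simps = hom_simps comp1_ob comp2_arr dom_comp2 cod_comp2 lwhisk_arr dom_lwhisk
  cod_lwhisk rwhisk_arr dom_rwhisk cod_rwhisk one_ob

lemma postcomp_functor_cat_functor:
  "\<lbrakk>X \<in> Obj B; Y \<in> Obj B; Z \<in> Obj B; g \<in> Ob (Hom B Y Z)\<rbrakk>
    \<Longrightarrow> cat_functor (Hom B X Y) (Hom B X Z) (postcomp_functor B X Y Z g)"
  by (rule cat_functor_arrI)
    (auto simp: postcomp_functor_def category_hom cell_simps lwhisk_id lwhisk_comp)

text \<open>Being a \<open>natural_iso\<close> presupposes that source and target are functors. For
  \<open>Kl\<close> this must be known before its associativity is available, so it is derived from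
  functoriality of composition alone.\<close>

lemma
  assumes "X \<in> Obj B" "Y \<in> Obj B" "Z \<in> Obj B" "W \<in> Obj B"
  shows left_nested_cat_functor:
    "cat_functor (Hom B Z W \<times>\<^sub>C Hom B Y Z \<times>\<^sub>C Hom B X Y) (Hom B X W)
      \<lparr>onOb = (\<lambda>(h, g, f). comp1 B X Y W (comp1 B Y Z W h g) f),
       onAr = (\<lambda>(\<gamma>, \<beta>, \<alpha>). comp2 B X Y W (comp2 B Y Z W \<gamma> \<beta>) \<alpha>)\<rparr>"
    and right_nested_cat_functor:
    "cat_functor (Hom B Z W \<times>\<^sub>C Hom B Y Z \<times>\<^sub>C Hom B X Y) (Hom B X W)
      \<lparr>onOb = (\<lambda>(h, g, f). comp1 B X Z W h (comp1 B X Y Z g f)),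
       onAr = (\<lambda>(\<gamma>, \<beta>, \<alpha>). comp2 B X Z W \<gamma> (comp2 B X Y Z \<beta> \<alpha>))\<rparr>"
  by (rule cat_functor_arrI;
      auto simp: assms category_prod category_hom prod_cat_simps cell_simps comp2_id interchange)+

end

context bicategory
begin

sublocale prebicategory B
  by (rule prebicategory.intro) (fact hom_category hcomp_functor one_hom)+

lemma
  assumes "X \<in> Obj B" "Y \<in> Obj B" "Z \<in> Obj B" "W \<in> Obj B"
    "f \<in> Ob (Hom B X Y)" "g \<in> Ob (Hom B Y Z)" "h \<in> Ob (Hom B Z W)"
  shows iso_assoc: "iso (Hom B X W) (Assoc B X Y Z W (h, g, f))"
    and assoc_arr: "Assoc B X Y Z W (h, g, f) \<in> Ar (Hom B X W)"
    and dom_assoc: "Dom (Hom B X W) (Assoc B X Y Z W (h, g, f))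
      = comp1 B X Y W (comp1 B Y Z W h g) f"
    and cod_assoc: "Cod (Hom B X W) (Assoc B X Y Z W (h, g, f))
      = comp1 B X Z W h (comp1 B X Y Z g f)"
proof -
  interpret natural_iso "Hom B Z W \<times>\<^sub>C Hom B Y Z \<times>\<^sub>C Hom B X Y" "Hom B X W"
    "\<lparr>onOb = (\<lambda>(h, g, f). comp1 B X Y W (comp1 B Y Z W h g) f),
      onAr = (\<lambda>(\<gamma>, \<beta>, \<alpha>). comp2 B X Y W (comp2 B Y Z W \<gamma> \<beta>) \<alpha>)\<rparr>"
    "\<lparr>onOb = (\<lambda>(h, g, f). comp1 B X Z W h (comp1 B X Y Z g f)),
      onAr = (\<lambda>(\<gamma>, \<beta>, \<alpha>). comp2 B X Z W \<gamma> (comp2 B X Y Z \<beta> \<alpha>))\<rparr>"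
    "Assoc B X Y Z W"
    by (rule assoc_natural_iso) fact+
  show "iso (Hom B X W) (Assoc B X Y Z W (h, g, f))"
    "Assoc B X Y Z W (h, g, f) \<in> Ar (Hom B X W)"
    "Dom (Hom B X W) (Assoc B X Y Z W (h, g, f)) = comp1 B X Y W (comp1 B Y Z W h g) f"
    "Cod (Hom B X W) (Assoc B X Y Z W (h, g, f)) = comp1 B X Z W h (comp1 B X Y Z g f)"
    using assms component_iso[of "(h, g, f)"] component_arr[of "(h, g, f)"]
      dom_component[of "(h, g, f)"] cod_component[of "(h, g, f)"]
    by (simp_all add: prod_cat_simps)
qed

lemma assoc_natural:
  assumes "X \<in> Obj B" "Y \<in> Obj B" "Z \<in> Obj B" "W \<in> Obj B"
    "\<alpha> \<in> Ar (Hom B X Y)" "\<beta> \<in> Ar (Hom B Y Z)" "\<gamma> \<in> Ar (Hom B Z W)"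
  shows "Assoc B X Y Z W (Cod (Hom B Z W) \<gamma>, Cod (Hom B Y Z) \<beta>, Cod (Hom B X Y) \<alpha>)
      \<cdot>\<^bsub>Hom B X W\<^esub> comp2 B X Y W (comp2 B Y Z W \<gamma> \<beta>) \<alpha>
    = comp2 B X Z W \<gamma> (comp2 B X Y Z \<beta> \<alpha>)
      \<cdot>\<^bsub>Hom B X W\<^esub> Assoc B X Y Z W (Dom (Hom B Z W) \<gamma>, Dom (Hom B Y Z) \<beta>, Dom (Hom B X Y) \<alpha>)"
  using natural_iso.natural_arr[OF assoc_natural_iso, of X Y Z W "(\<gamma>, \<beta>, \<alpha>)"] assms
  by (simp add: prod_cat_simps)

text \<open>Naturality of the associator with identities in two of the three arguments. This variant
  carries \<mu> of the two leftmost 1-cells across the associator; the next one carries \<theta> or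
  \<mu> across it under a left whisker.\<close>

lemma assoc_natural_left:
  assumes "X \<in> Obj B" "Y \<in> Obj B" "Z \<in> Obj B" "W \<in> Obj B"
    "f \<in> Ob (Hom B X Y)" "g \<in> Ob (Hom B Y Z)" "\<gamma> \<in> Ar (Hom B Z W)"
  shows "Assoc B X Y Z W (Cod (Hom B Z W) \<gamma>, g, f)
      \<cdot>\<^bsub>Hom B X W\<^esub> rwhisk B X Y W (rwhisk B Y Z W \<gamma> g) f
    = rwhisk B X Z W \<gamma> (comp1 B X Y Z g f)
      \<cdot>\<^bsub>Hom B X W\<^esub> Assoc B X Y Z W (Dom (Hom B Z W) \<gamma>, g, f)"
  using assoc_natural[of X Y Z W "Idn (Hom B X Y) f" "Idn (Hom B Y Z) g" \<gamma>] assms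
  by (simp add: rwhisk_def comp2_id cell_simps)

lemma assoc_natural_middle:
  assumes "X \<in> Obj B" "Y \<in> Obj B" "Z \<in> Obj B" "W \<in> Obj B"
    "f \<in> Ob (Hom B X Y)" "\<beta> \<in> Ar (Hom B Y Z)" "h \<in> Ob (Hom B Z W)"
  shows "Assoc B X Y Z W (h, Cod (Hom B Y Z) \<beta>, f)
      \<cdot>\<^bsub>Hom B X W\<^esub> rwhisk B X Y W (lwhisk B Y Z W h \<beta>) f
    = lwhisk B X Z W h (rwhisk B X Y Z \<beta> f)
      \<cdot>\<^bsub>Hom B X W\<^esub> Assoc B X Y Z W (h, Dom (Hom B Y Z) \<beta>, f)"
  using assoc_natural[of X Y Z W "Idn (Hom B X Y) f" \<beta> "Idn (Hom B Z W) h"] assms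
  by (simp add: rwhisk_def lwhisk_def comp2_id cell_simps)

lemma
  assumes "X \<in> Obj B" "Y \<in> Obj B" "f \<in> Ob (Hom B X Y)"
  shows iso_lunit: "iso (Hom B X Y) (LUnit B X Y f)"
    and lunit_arr: "LUnit B X Y f \<in> Ar (Hom B X Y)"
    and dom_lunit: "Dom (Hom B X Y) (LUnit B X Y f) = comp1 B X Y Y (One B Y) f"
    and cod_lunit: "Cod (Hom B X Y) (LUnit B X Y f) = f"
  using natural_iso.component_iso[OF lunit_natural_iso, of X Y f]
    natural_iso.component_arr[OF lunit_natural_iso, of X Y f]
    natural_iso.dom_component[OF lunit_natural_iso, of X Y f]
    natural_iso.cod_component[OF lunit_natural_iso, of X Y f] assms
  by (simp_all add: postcomp_functor_def id_functor_def)

lemma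
  assumes "X \<in> Obj B" "Y \<in> Obj B" "f \<in> Ob (Hom B X Y)"
  shows runit_arr: "RUnit B X Y f \<in> Ar (Hom B X Y)"
    and dom_runit: "Dom (Hom B X Y) (RUnit B X Y f) = comp1 B X X Y f (One B X)"
    and cod_runit: "Cod (Hom B X Y) (RUnit B X Y f) = f"
  using natural_iso.component_arr[OF runit_natural_iso, of X Y f]
    natural_iso.dom_component[OF runit_natural_iso, of X Y f]
    natural_iso.cod_component[OF runit_natural_iso, of X Y f] assms
  by (simp_all add: precomp_functor_def id_functor_def)

lemma lunit_natural:
  assumes "X \<in> Obj B" "Y \<in> Obj B" "\<alpha> \<in> Ar (Hom B X Y)"
  shows "LUnit B X Y (Cod (Hom B X Y) \<alpha>) \<cdot>\<^bsub>Hom B X Y\<^esub> lwhisk B X Y Y (One B Y) \<alpha>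
    = \<alpha> \<cdot>\<^bsub>Hom B X Y\<^esub> LUnit B X Y (Dom (Hom B X Y) \<alpha>)"
  using natural_iso.natural_arr[OF lunit_natural_iso, of X Y \<alpha>] assms
  by (simp add: postcomp_functor_def id_functor_def)

text \<open>Whiskering with \<open>\<tau>\<close> followed by the left unitor is a transformation
  from whiskering with \<open>g\<close> to the identity functor. Its naturality is the exchange law
  for \<open>\<tau>\<close> and \<open>\<alpha>\<close> followed by naturality of the unitor. With
  \<theta> as \<open>\<tau>\<close> this transformation is the left unit of Kl.\<close>

lemma lunit_whisk_natural:
  assumes XY: "X \<in> Obj B" "Y \<in> Obj B" and \<tau>: "\<tau> \<in> Ar (Hom B Y Y)"
      "Dom (Hom B Y Y) \<tau> = g" "Cod (Hom B Y Y) \<tau> = One B Y"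
    and \<alpha>: "\<alpha> \<in> Ar (Hom B X Y)" "Dom (Hom B X Y) \<alpha> = a" "Cod (Hom B X Y) \<alpha> = b"
  shows "(LUnit B X Y b \<cdot>\<^bsub>Hom B X Y\<^esub> rwhisk B X Y Y \<tau> b) \<cdot>\<^bsub>Hom B X Y\<^esub> lwhisk B X Y Y g \<alpha>
    = \<alpha> \<cdot>\<^bsub>Hom B X Y\<^esub> (LUnit B X Y a \<cdot>\<^bsub>Hom B X Y\<^esub> rwhisk B X Y Y \<tau> a)"
proof -
  interpret H: category "Hom B X Y" by (rule category_hom) fact+
  have g: "g \<in> Ob (Hom B Y Y)"
    using \<tau> category.dom_ob[OF category_hom[OF XY(2) XY(2)]] by blast
  have ab: "a \<in> Ob (Hom B X Y)" "b \<in> Ob (Hom B X Y)"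
    using \<alpha> H.dom_ob H.cod_ob by blast+
  note s = XY \<tau> \<alpha> g ab cell_simps lunit_arr dom_lunit cod_lunit H.comp_assoc_arr
  have "(LUnit B X Y b \<cdot>\<^bsub>Hom B X Y\<^esub> rwhisk B X Y Y \<tau> b) \<cdot>\<^bsub>Hom B X Y\<^esub> lwhisk B X Y Y g \<alpha>
      = LUnit B X Y b \<cdot>\<^bsub>Hom B X Y\<^esub> (rwhisk B X Y Y \<tau> b \<cdot>\<^bsub>Hom B X Y\<^esub> lwhisk B X Y Y g \<alpha>)"
    by (simp add: s)
  also have "\<dots> = LUnit B X Y b \<cdot>\<^bsub>Hom B X Y\<^esub>
      (lwhisk B X Y Y (One B Y) \<alpha> \<cdot>\<^bsub>Hom B X Y\<^esub> rwhisk B X Y Y \<tau> a)"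
    using whisk_exchange[OF XY(1) XY(2) XY(2) \<tau>(1) \<alpha>(1)] \<alpha> \<tau> by simp
  also have "\<dots> = (LUnit B X Y b \<cdot>\<^bsub>Hom B X Y\<^esub> lwhisk B X Y Y (One B Y) \<alpha>)
      \<cdot>\<^bsub>Hom B X Y\<^esub> rwhisk B X Y Y \<tau> a"
    by (simp add: s)
  also have "\<dots> = (\<alpha> \<cdot>\<^bsub>Hom B X Y\<^esub> LUnit B X Y a) \<cdot>\<^bsub>Hom B X Y\<^esub> rwhisk B X Y Y \<tau> a"
    using lunit_natural[OF XY \<alpha>(1)] \<alpha> by simp
  also have "\<dots> = \<alpha> \<cdot>\<^bsub>Hom B X Y\<^esub> (LUnit B X Y a \<cdot>\<^bsub>Hom B X Y\<^esub> rwhisk B X Y Y \<tau> a)"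
    by (simp add: s)
  finally show ?thesis .
qed

lemma iso_lunit_whisk:
  assumes "X \<in> Obj B" "Y \<in> Obj B" "iso (Hom B Y Y) \<tau>" "Cod (Hom B Y Y) \<tau> = One B Y"
    "f \<in> Ob (Hom B X Y)"
  shows "iso (Hom B X Y) (LUnit B X Y f \<cdot>\<^bsub>Hom B X Y\<^esub> rwhisk B X Y Y \<tau> f)"
proof -
  have "\<tau> \<in> Ar (Hom B Y Y)"
    using assms category.iso_arr[OF category_hom] by blast
  then show ?thesis
    by (intro category.iso_comp[OF category_hom] iso_lunit iso_rwhisk assms)
      (simp add: assms cell_simps dom_lunit)
qed

text \<open>\<open>\<tau>\<close> makes whiskering with \<open>g\<close> isomorphic to the identity functor, hence faithful.\<close>

lemma lwhisk_cancel:
  assumes XY: "X \<in> Obj B" "Y \<in> Obj B" and \<tau>: "iso (Hom B Y Y) \<tau>"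
      "Dom (Hom B Y Y) \<tau> = g" "Cod (Hom B Y Y) \<tau> = One B Y"
    and \<alpha>: "\<alpha> \<in> Ar (Hom B X Y)" "\<alpha>' \<in> Ar (Hom B X Y)"
      "Dom (Hom B X Y) \<alpha> = Dom (Hom B X Y) \<alpha>'" "Cod (Hom B X Y) \<alpha> = Cod (Hom B X Y) \<alpha>'"
    and eq: "lwhisk B X Y Y g \<alpha> = lwhisk B X Y Y g \<alpha>'"
  shows "\<alpha> = \<alpha>'"
proof -
  interpret H: category "Hom B X Y" by (rule category_hom) fact+
  have \<tau>_arr: "\<tau> \<in> Ar (Hom B Y Y)"
    using \<tau>(1) category.iso_arr[OF category_hom[OF XY(2) XY(2)]] by blast
  let ?a = "Dom (Hom B X Y) \<alpha>"
  let ?u = "LUnit B X Y ?a \<cdot>\<^bsub>Hom B X Y\<^esub> rwhisk B X Y Y \<tau> ?a"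
  \<comment> \<open>By naturality each side is the whiskered 2-cell followed by the component at the
    common target, so \<open>eq\<close> identifies them.\<close>
  have "\<alpha> \<cdot>\<^bsub>Hom B X Y\<^esub> ?u = \<alpha>' \<cdot>\<^bsub>Hom B X Y\<^esub> ?u"
    using lunit_whisk_natural[OF XY \<tau>_arr \<tau>(2,3) \<alpha>(1) refl refl]
      lunit_whisk_natural[OF XY \<tau>_arr \<tau>(2,3) \<alpha>(2) refl refl] \<alpha> eq
    by simp
  moreover have "iso (Hom B X Y) ?u" "Cod (Hom B X Y) ?u = ?a"
    using iso_lunit_whisk[OF XY \<tau>(1,3)] XY \<tau>_arr \<tau> \<alpha>
    by (simp_all add: cell_simps lunit_arr dom_lunit cod_lunit)
  ultimately show ?thesis
    using \<alpha> by - (rule H.iso_cancel_right[of ?u], simp_all)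
qed

end

section \<open>The Kleisli bicategory\<close>

context relative_pseudomonad
begin

abbreviation JT :: "'co \<Rightarrow> 'co \<Rightarrow> ('m, 'c) cat_data"
  where "JT X Y \<equiv> Hom D (PObj J X) (TOb T Y)"

abbreviation TT :: "'co \<Rightarrow> 'co \<Rightarrow> ('m, 'c) cat_data"
  where "TT X Y \<equiv> Hom D (TOb T X) (TOb T Y)"

abbreviation ext1 :: "'co \<Rightarrow> 'co \<Rightarrow> 'm \<Rightarrow> 'm"
  where "ext1 X Y f \<equiv> onOb (Ext T X Y) f"

abbreviation ext2 :: "'co \<Rightarrow> 'co \<Rightarrow> 'c \<Rightarrow> 'c"
  where "ext2 X Y \<alpha> \<equiv> onAr (Ext T X Y) \<alpha>"

abbreviation Kl :: "('co, 'm, 'c) bicat_data"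
  where "Kl \<equiv> kleisli_bicat C D J T"

section \<open>The cells of the relative pseudomonad as rewrite rules\<close>

lemmas ext_simps = cat_functor.ob[OF ext_functor] cat_functor.on_arr[OF ext_functor]
  cat_functor.dom_on_arr[OF ext_functor] cat_functor.cod_on_arr[OF ext_functor]
  t_unit

lemmas ext2_id = cat_functor.pres_id[OF ext_functor]
lemmas ext2_comp = cat_functor.pres_comp_arr[OF ext_functor]
lemmas iso_ext2 = cat_functor.pres_iso[OF ext_functor]

lemma
  assumes "X \<in> Obj C" "Y \<in> Obj C" "Z \<in> Obj C" "f \<in> Ob (JT X Y)" "g \<in> Ob (JT Y Z)"
  shows iso_mu: "iso (TT X Z) (Mu T X Y Z (g, f))"
    and mu_arr: "Mu T X Y Z (g, f) \<in> Ar (TT X Z)"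
    and dom_mu: "Dom (TT X Z) (Mu T X Y Z (g, f))
      = ext1 X Z (comp1 D (PObj J X) (TOb T Y) (TOb T Z) (ext1 Y Z g) f)"
    and cod_mu: "Cod (TT X Z) (Mu T X Y Z (g, f))
      = comp1 D (TOb T X) (TOb T Y) (TOb T Z) (ext1 Y Z g) (ext1 X Y f)"
  using natural_iso.component_iso[OF mu_natural_iso, of X Y Z "(g, f)"]
    natural_iso.component_arr[OF mu_natural_iso, of X Y Z "(g, f)"]
    natural_iso.dom_component[OF mu_natural_iso, of X Y Z "(g, f)"]
    natural_iso.cod_component[OF mu_natural_iso, of X Y Z "(g, f)"] assms
  by (simp_all add: prod_cat_simps comp_functor_def kl_hcomp_def prod_functor_def id_functor_def
      comp1_def)

lemma mu_natural:
  assumes "X \<in> Obj C" "Y \<in> Obj C" "Z \<in> Obj C" "\<alpha> \<in> Ar (JT X Y)" "\<beta> \<in> Ar (JT Y Z)"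
  shows "Mu T X Y Z (Cod (JT Y Z) \<beta>, Cod (JT X Y) \<alpha>)
      \<cdot>\<^bsub>TT X Z\<^esub> ext2 X Z (comp2 D (PObj J X) (TOb T Y) (TOb T Z) (ext2 Y Z \<beta>) \<alpha>)
    = comp2 D (TOb T X) (TOb T Y) (TOb T Z) (ext2 Y Z \<beta>) (ext2 X Y \<alpha>)
      \<cdot>\<^bsub>TT X Z\<^esub> Mu T X Y Z (Dom (JT Y Z) \<beta>, Dom (JT X Y) \<alpha>)"
  using natural_iso.natural_arr[OF mu_natural_iso, of X Y Z "(\<beta>, \<alpha>)"] assms
  by (simp add: prod_cat_simps comp_functor_def kl_hcomp_def prod_functor_def id_functor_def
      comp2_def)

lemma
  assumes "X \<in> Obj C" "Y \<in> Obj C" "f \<in> Ob (JT X Y)"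
  shows iso_eta: "iso (JT X Y) (Eta T X Y f)"
    and eta_arr: "Eta T X Y f \<in> Ar (JT X Y)"
    and dom_eta: "Dom (JT X Y) (Eta T X Y f) = f"
    and cod_eta: "Cod (JT X Y) (Eta T X Y f)
      = comp1 D (PObj J X) (TOb T X) (TOb T Y) (ext1 X Y f) (TUnit T X)"
  using natural_iso.component_iso[OF eta_natural_iso, of X Y f]
    natural_iso.component_arr[OF eta_natural_iso, of X Y f]
    natural_iso.dom_component[OF eta_natural_iso, of X Y f]
    natural_iso.cod_component[OF eta_natural_iso, of X Y f] assms
  by (simp_all add: comp_functor_def precomp_functor_def id_functor_def)

lemma
  assumes "X \<in> Obj C"
  shows theta_arr: "Theta T X \<in> Ar (TT X X)"
    and dom_theta: "Dom (TT X X) (Theta T X) = ext1 X X (TUnit T X)"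
    and cod_theta: "Cod (TT X X) (Theta T X) = One D (TOb T X)"
  using theta[OF assms] by (auto simp: in_hom_def)

text \<open>Sources and targets of all 2-cells in play. A link of a calculation that is closed by
  simp with these rules and \<open>vassoc\<close> alone is mere rebracketing; the mathematical links
  cite a naturality, an axiom or a distribution of whiskering.\<close>

lemmas tsimps = J.p_obj t_obj ext_simps mu_arr dom_mu cod_mu eta_arr dom_eta cod_eta theta_arr
  dom_theta cod_theta J.cod.cell_simps J.cod.assoc_arr J.cod.dom_assoc J.cod.cod_assoc
  J.cod.lunit_arr J.cod.dom_lunit J.cod.cod_lunit J.cod.runit_arr J.cod.dom_runit J.cod.cod_runit

lemmas vassoc = category.comp_assoc_arr[OF J.cod.category_hom]

section \<open>The unit axiom and the left unit coherence\<close>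

text \<open>The unit axiom says that this composite is a left inverse of
  \<open>ext2 X Y (Eta T X Y g)\<close>; as \<eta> is invertible and functors preserve inverses, the
  composite is the image of the inverse. Since that inverse is the right unit of Kl, this is at once
  the right unit coherence of the pseudofunctor to D.\<close>

lemma unit_law_inverse:
  assumes XY: "X \<in> Obj C" "Y \<in> Obj C" "g \<in> Ob (JT X Y)"
  shows "RUnit D (TOb T X) (TOb T Y) (ext1 X Y g)
      \<cdot>\<^bsub>TT X Y\<^esub> (lwhisk D (TOb T X) (TOb T X) (TOb T Y) (ext1 X Y g) (Theta T X)
      \<cdot>\<^bsub>TT X Y\<^esub> Mu T X X Y (g, TUnit T X))
    = ext2 X Y (inv_of (JT X Y) (Eta T X Y g))"
proof -
  interpret H: category "TT X Y" by (rule J.cod.category_hom) (simp_all add: XY t_obj)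
  interpret E: cat_functor "JT X Y" "TT X Y" "Ext T X Y" by (rule ext_functor) fact+
  note s = XY tsimps
  have iso: "iso (JT X Y) (Eta T X Y g)"
    by (rule iso_eta) fact+
  have inv: "ext2 X Y (inv_of (JT X Y) (Eta T X Y g)) \<cdot>\<^bsub>TT X Y\<^esub> ext2 X Y (Eta T X Y g)
      = Idn (TT X Y) (ext1 X Y g)"
    using H.inv_of_comp[OF E.pres_iso[OF iso]] by (simp add: E.pres_inv_of[OF iso] s)
  show ?thesis
    by (rule H.iso_cancel_right[OF E.pres_iso[OF iso]])
      (simp_all add: s E.dom.inv_of_arr[OF iso] E.dom.dom_inv_of[OF iso] inv
        t_unit_law[OF XY, symmetric] vassoc)
qed

text \<open>The previous equation is whiskered on the right with \<open>h\<close>, and the triangle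
  of D trades its right unitor for the left unitor. For \<open>W\<close> in the image of J this is
  the triangle of Kl; for \<open>W\<close> in the image of T it enters the left unit
  coherence.\<close>

lemma whiskered_unit_law:
  assumes W: "W \<in> Obj D" and X: "X \<in> Obj C" and Y: "Y \<in> Obj C" and g: "g \<in> Ob (JT X Y)"
    and h: "h \<in> Ob (Hom D W (TOb T X))"
  shows "lwhisk D W (TOb T X) (TOb T Y) (ext1 X Y g)
        (LUnit D W (TOb T X) h
          \<cdot>\<^bsub>Hom D W (TOb T X)\<^esub> rwhisk D W (TOb T X) (TOb T X) (Theta T X) h)
      \<cdot>\<^bsub>Hom D W (TOb T Y)\<^esub>
        (Assoc D W (TOb T X) (TOb T X) (TOb T Y) (ext1 X Y g, ext1 X X (TUnit T X), h)
          \<cdot>\<^bsub>Hom D W (TOb T Y)\<^esub> rwhisk D W (TOb T X) (TOb T Y) (Mu T X X Y (g, TUnit T X)) h)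
    = rwhisk D W (TOb T X) (TOb T Y) (ext2 X Y (inv_of (JT X Y) (Eta T X Y g))) h"
proof -
  let ?H = "Hom D W (TOb T Y)"
  let ?lw = "lwhisk D W (TOb T X) (TOb T Y) (ext1 X Y g)"
  let ?rw = "\<lambda>\<beta>. rwhisk D W (TOb T X) (TOb T Y) \<beta> h"
  let ?l = "LUnit D W (TOb T X) h"
  let ?rt = "rwhisk D W (TOb T X) (TOb T X) (Theta T X) h"
  let ?m = "Mu T X X Y (g, TUnit T X)"
  let ?a = "Assoc D W (TOb T X) (TOb T X) (TOb T Y) (ext1 X Y g, ext1 X X (TUnit T X), h)"
  let ?lt = "lwhisk D (TOb T X) (TOb T X) (TOb T Y) (ext1 X Y g) (Theta T X)"
  let ?a' = "Assoc D W (TOb T X) (TOb T X) (TOb T Y) (ext1 X Y g, One D (TOb T X), h)"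
  let ?r = "RUnit D (TOb T X) (TOb T Y) (ext1 X Y g)"
  note s = W X Y g h tsimps vassoc
  have "?lw (?l \<cdot>\<^bsub>Hom D W (TOb T X)\<^esub> ?rt) \<cdot>\<^bsub>?H\<^esub> (?a \<cdot>\<^bsub>?H\<^esub> ?rw ?m)
      = ?lw ?l \<cdot>\<^bsub>?H\<^esub> ((?lw ?rt \<cdot>\<^bsub>?H\<^esub> ?a) \<cdot>\<^bsub>?H\<^esub> ?rw ?m)"
    by (simp add: s J.cod.lwhisk_comp)
  \<comment> \<open>Moving \<theta> across the associator turns the middle 1-cell into an identity,
    which makes the triangle of D applicable.\<close>
  also have "?lw ?rt \<cdot>\<^bsub>?H\<^esub> ?a = ?a' \<cdot>\<^bsub>?H\<^esub> ?rw ?lt"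
    using J.cod.assoc_natural_middle[of W "TOb T X" "TOb T X" "TOb T Y" h "Theta T X" "ext1 X Y g"]
    by (simp add: s)
  also have "?lw ?l \<cdot>\<^bsub>?H\<^esub> ((?a' \<cdot>\<^bsub>?H\<^esub> ?rw ?lt) \<cdot>\<^bsub>?H\<^esub> ?rw ?m)
      = (?lw ?l \<cdot>\<^bsub>?H\<^esub> ?a') \<cdot>\<^bsub>?H\<^esub> (?rw ?lt \<cdot>\<^bsub>?H\<^esub> ?rw ?m)"
    by (simp add: s)
  also have "?lw ?l \<cdot>\<^bsub>?H\<^esub> ?a' = ?rw ?r"
    by (rule J.cod.triangle) (simp_all add: s)
  also have "?rw ?r \<cdot>\<^bsub>?H\<^esub> (?rw ?lt \<cdot>\<^bsub>?H\<^esub> ?rw ?m)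
      = ?rw (?r \<cdot>\<^bsub>TT X Y\<^esub> (?lt \<cdot>\<^bsub>TT X Y\<^esub> ?m))"
    by (simp add: s J.cod.rwhisk_comp)
  also have "\<dots> = ?rw (ext2 X Y (inv_of (JT X Y) (Eta T X Y g)))"
    by (simp only: unit_law_inverse[OF X Y g])
  finally show ?thesis .
qed

text \<open>
  The left unit coherence of \<open>(-)*\<close> is not among the axioms. As in Kelly's reduction of the
  axioms of a monoidal category, it holds after whiskering with \<open>(i_Y)*\<close>, which can be cancelled
  because of \<open>\<theta>_Y\<close>.
\<close>

lemma ext2_left_unit:
  assumes X: "X \<in> Obj C" and Y: "Y \<in> Obj C" and f: "f \<in> Ob (JT X Y)"
  shows "(LUnit D (TOb T X) (TOb T Y) (ext1 X Y f)
        \<cdot>\<^bsub>TT X Y\<^esub> rwhisk D (TOb T X) (TOb T Y) (TOb T Y) (Theta T Y) (ext1 X Y f))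
      \<cdot>\<^bsub>TT X Y\<^esub> Mu T X Y Y (TUnit T Y, f)
    = ext2 X Y (LUnit D (PObj J X) (TOb T Y) f
        \<cdot>\<^bsub>JT X Y\<^esub> rwhisk D (PObj J X) (TOb T Y) (TOb T Y) (Theta T Y) f)"
    (is "?u \<cdot>\<^bsub>_\<^esub> ?m = ext2 X Y ?v")
proof -
  let ?g = "TUnit T Y"
  let ?lw = "lwhisk D (TOb T X) (TOb T Y) (TOb T Y) (ext1 Y Y ?g)"
  let ?gf = "comp1 D (PObj J X) (TOb T Y) (TOb T Y) (ext1 Y Y ?g) f"
  let ?gg = "comp1 D (PObj J Y) (TOb T Y) (TOb T Y) (ext1 Y Y ?g) ?g"
  let ?w = "Assoc D (PObj J X) (TOb T Y) (TOb T Y) (TOb T Y) (ext1 Y Y ?g, ext1 Y Y ?g, f)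
    \<cdot>\<^bsub>JT X Y\<^esub> rwhisk D (PObj J X) (TOb T Y) (TOb T Y) (Mu T Y Y Y (?g, ?g)) f"
  let ?w' = "Assoc D (TOb T X) (TOb T Y) (TOb T Y) (TOb T Y) (ext1 Y Y ?g, ext1 Y Y ?g, ext1 X Y f)
    \<cdot>\<^bsub>TT X Y\<^esub> rwhisk D (TOb T X) (TOb T Y) (TOb T Y) (Mu T Y Y Y (?g, ?g)) (ext1 X Y f)"
  let ?e = "ext2 Y Y (inv_of (JT Y Y) (Eta T Y Y ?g))"
  interpret H: category "TT X Y" by (rule J.cod.category_hom) (simp_all add: X Y t_obj)
  interpret K: category "JT Y Y" by (rule J.cod.category_hom) (simp_all add: Y t_obj J.p_obj)
  have iso: "iso (JT Y Y) (Eta T Y Y ?g)"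
    by (rule iso_eta) (simp_all add: Y t_unit)
  note s = X Y f tsimps vassoc K.inv_of_arr[OF iso] K.dom_inv_of[OF iso] K.cod_inv_of[OF iso]
  \<comment> \<open>This auxiliary cell is invertible and is cancelled at the end; with it attached,
    the associativity axiom for f and two copies of the unit of Y applies.\<close>
  let ?c = "Mu T X Y Y (?g, ?gf) \<cdot>\<^bsub>TT X Y\<^esub> ext2 X Y ?w"
  have "?lw (?u \<cdot>\<^bsub>TT X Y\<^esub> ?m) \<cdot>\<^bsub>TT X Y\<^esub> ?c
      = ?lw ?u \<cdot>\<^bsub>TT X Y\<^esub> (?lw ?m \<cdot>\<^bsub>TT X Y\<^esub> Mu T X Y Y (?g, ?gf) \<cdot>\<^bsub>TT X Y\<^esub> ext2 X Y ?w)"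
    by (simp add: s J.cod.lwhisk_comp)
  also have "\<dots> = ?lw ?u \<cdot>\<^bsub>TT X Y\<^esub> (?w' \<cdot>\<^bsub>TT X Y\<^esub> Mu T X Y Y (?gg, f))"
    by (subst t_assoc) (simp_all add: s)
  also have "\<dots> = (?lw ?u \<cdot>\<^bsub>TT X Y\<^esub> ?w') \<cdot>\<^bsub>TT X Y\<^esub> Mu T X Y Y (?gg, f)"
    by (simp add: s)
  \<comment> \<open>The unit law with source TX collapses the unit cells to the image of the inverse
    of \<eta>. Naturality of \<mu> in its outer argument then moves this under \<open>Ext\<close>,
    where the unit law with source JX expands it again.\<close>
  also have "?lw ?u \<cdot>\<^bsub>TT X Y\<^esub> ?w' = rwhisk D (TOb T X) (TOb T Y) (TOb T Y) ?e (ext1 X Y f)"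
    by (rule whiskered_unit_law) (simp_all add: s)
  also have "\<dots> \<cdot>\<^bsub>TT X Y\<^esub> Mu T X Y Y (?gg, f)
      = Mu T X Y Y (?g, f) \<cdot>\<^bsub>TT X Y\<^esub> ext2 X Y (rwhisk D (PObj J X) (TOb T Y) (TOb T Y) ?e f)"
    using mu_natural[of X Y Y "Idn (JT X Y) f" "inv_of (JT Y Y) (Eta T Y Y ?g)"]
    by (simp add: s ext2_id rwhisk_def)
  also have "rwhisk D (PObj J X) (TOb T Y) (TOb T Y) ?e f
      = lwhisk D (PObj J X) (TOb T Y) (TOb T Y) (ext1 Y Y ?g) ?v \<cdot>\<^bsub>JT X Y\<^esub> ?w"
    by (rule whiskered_unit_law[symmetric]) (simp_all add: s)
  also have "Mu T X Y Y (?g, f) \<cdot>\<^bsub>TT X Y\<^esub> ext2 X Y \<dots>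
      = (Mu T X Y Y (?g, f) \<cdot>\<^bsub>TT X Y\<^esub>
          ext2 X Y (lwhisk D (PObj J X) (TOb T Y) (TOb T Y) (ext1 Y Y ?g) ?v))
        \<cdot>\<^bsub>TT X Y\<^esub> ext2 X Y ?w"
    by (simp add: s ext2_comp)
  \<comment> \<open>Naturality of \<mu> in its inner argument exchanges \<open>Ext\<close> with the
    left whisker and so exposes the common tail \<open>?c\<close>.\<close>
  also have "Mu T X Y Y (?g, f) \<cdot>\<^bsub>TT X Y\<^esub>
        ext2 X Y (lwhisk D (PObj J X) (TOb T Y) (TOb T Y) (ext1 Y Y ?g) ?v)
      = ?lw (ext2 X Y ?v) \<cdot>\<^bsub>TT X Y\<^esub> Mu T X Y Y (?g, ?gf)"
    using mu_natural[of X Y Y ?v "Idn (JT Y Y) ?g"]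
    by (simp add: s ext2_id lwhisk_def)
  also have "(?lw (ext2 X Y ?v) \<cdot>\<^bsub>TT X Y\<^esub> Mu T X Y Y (?g, ?gf)) \<cdot>\<^bsub>TT X Y\<^esub> ext2 X Y ?w
      = ?lw (ext2 X Y ?v) \<cdot>\<^bsub>TT X Y\<^esub> ?c"
    by (simp add: s)
  finally have eq: "?lw (?u \<cdot>\<^bsub>TT X Y\<^esub> ?m) \<cdot>\<^bsub>TT X Y\<^esub> ?c = ?lw (ext2 X Y ?v) \<cdot>\<^bsub>TT X Y\<^esub> ?c" .
  have "iso (JT X Y) ?w"
    by (rule category.iso_comp[OF J.cod.category_hom])
      (simp_all add: s J.cod.iso_assoc J.cod.iso_rwhisk iso_mu)
  then have "iso (TT X Y) ?c"
    by (intro H.iso_comp iso_mu iso_ext2) (simp_all add: s)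
  from H.iso_cancel_right[OF this _ _ _ _ eq]
  have "?lw (?u \<cdot>\<^bsub>TT X Y\<^esub> ?m) = ?lw (ext2 X Y ?v)"
    by (simp add: s)
  then show ?thesis
    by (rule J.cod.lwhisk_cancel[where \<tau> = "Theta T Y", rotated -1]) (simp_all add: s theta_iso)
qed

section \<open>Structure and coherence of the Kleisli bicategory\<close>

lemma kleisli_simps:
  "Obj Kl = Obj C" "Hom Kl X Y = JT X Y" "One Kl X = TUnit T X"
  "HComp Kl X Y Z = kl_hcomp D J T X Y Z"
  "Assoc Kl X Y Z W (h, g, f) =
    Assoc D (PObj J X) (TOb T Y) (TOb T Z) (TOb T W) (ext1 Z W h, ext1 Y Z g, f)
    \<cdot>\<^bsub>JT X W\<^esub> rwhisk D (PObj J X) (TOb T Y) (TOb T W) (Mu T Y Z W (h, g)) f"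
  "LUnit Kl X Y f = LUnit D (PObj J X) (TOb T Y) f
    \<cdot>\<^bsub>JT X Y\<^esub> rwhisk D (PObj J X) (TOb T Y) (TOb T Y) (Theta T Y) f"
  "RUnit Kl X Y f = inv_of (JT X Y) (Eta T X Y f)"
  by (simp_all add: kleisli_bicat_def)

lemma kleisli_comp:
  "comp1 Kl X Y Z g f = comp1 D (PObj J X) (TOb T Y) (TOb T Z) (ext1 Y Z g) f"
  "comp2 Kl X Y Z \<beta> \<alpha> = comp2 D (PObj J X) (TOb T Y) (TOb T Z) (ext2 Y Z \<beta>) \<alpha>"
  by (simp_all add: comp1_def comp2_def kleisli_bicat_def kl_hcomp_def comp_functor_def
      prod_functor_def id_functor_def)

lemma kleisli_rwhisk:
  "rwhisk Kl X Y Z \<beta> f = rwhisk D (PObj J X) (TOb T Y) (TOb T Z) (ext2 Y Z \<beta>) f"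
  by (simp add: rwhisk_def kleisli_comp kleisli_simps)

text \<open>Composition in Kl extends its left factor, so this whisker contains \<open>ext2\<close>
  of an identity. Turning that into the identity on \<open>ext1 Y Z g\<close> uses functoriality of
  \<open>Ext\<close>, hence the hypotheses that right whiskering does not have.\<close>

lemma kleisli_lwhisk:
  "\<lbrakk>Y \<in> Obj C; Z \<in> Obj C; g \<in> Ob (JT Y Z)\<rbrakk>
    \<Longrightarrow> lwhisk Kl X Y Z g \<alpha> = lwhisk D (PObj J X) (TOb T Y) (TOb T Z) (ext1 Y Z g) \<alpha>"
  by (simp add: lwhisk_def kleisli_comp kleisli_simps ext2_id)

lemma kleisli_prebicategory: "prebicategory Kl"
proof (rule prebicategory.intro; unfold kleisli_simps kl_hcomp_def)
  show "category (JT X Y)" if "X \<in> Obj C" "Y \<in> Obj C" for X Y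
    using that by (simp add: J.cod.category_hom J.p_obj t_obj)
  show "cat_functor (JT Y Z \<times>\<^sub>C JT X Y) (JT X Z)
      (HComp D (PObj J X) (TOb T Y) (TOb T Z) \<circ>\<^sub>F (Ext T Y Z \<times>\<^sub>F id_functor))"
    if "X \<in> Obj C" "Y \<in> Obj C" "Z \<in> Obj C" for X Y Z
    using that
    by (intro cat_functor_comp[OF cat_functor_prod[OF ext_functor cat_functor_id]]
        J.cod.functor_hcomp J.cod.category_hom) (simp_all add: J.p_obj t_obj)
  show "TUnit T X \<in> Ob (JT X X)" if "X \<in> Obj C" for X
    using that by (rule t_unit)
qed

interpretation Kl: prebicategory Kl
  by (rule kleisli_prebicategory)

text \<open>The associator of Kl is that of D after a whiskered \<mu>. Its naturality square is the
  pasting of the square for \<mu> with the square for the associator of D at the innermost 2-cell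
  and the extensions of the outer two.\<close>

lemma kleisli_assoc_natural_iso:
  assumes X: "X \<in> Obj C" and Y: "Y \<in> Obj C" and Z: "Z \<in> Obj C" and W: "W \<in> Obj C"
  shows "natural_iso (JT Z W \<times>\<^sub>C JT Y Z \<times>\<^sub>C JT X Y) (JT X W)
    \<lparr>onOb = (\<lambda>(h, g, f). comp1 Kl X Y W (comp1 Kl Y Z W h g) f),
     onAr = (\<lambda>(\<gamma>, \<beta>, \<alpha>). comp2 Kl X Y W (comp2 Kl Y Z W \<gamma> \<beta>) \<alpha>)\<rparr>
    \<lparr>onOb = (\<lambda>(h, g, f). comp1 Kl X Z W h (comp1 Kl X Y Z g f)),
     onAr = (\<lambda>(\<gamma>, \<beta>, \<alpha>). comp2 Kl X Z W \<gamma> (comp2 Kl X Y Z \<beta> \<alpha>))\<rparr>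
    (Assoc Kl X Y Z W)"
    (is "natural_iso ?P ?H ?L ?R _")
proof (rule natural_iso_arrI)
  note s = X Y Z W tsimps vassoc kleisli_simps kleisli_comp prod_cat_simps
  show "cat_functor ?P ?H ?L" "cat_functor ?P ?H ?R"
    using Kl.left_nested_cat_functor[of X Y Z W] Kl.right_nested_cat_functor[of X Y Z W]
    by (simp_all add: X Y Z W kleisli_simps)
  fix a
  assume "a \<in> Ob ?P"
  then obtain h g f where a: "a = (h, g, f)" "h \<in> Ob (JT Z W)" "g \<in> Ob (JT Y Z)" "f \<in> Ob (JT X Y)"
    by (cases a) (auto simp: prod_cat_simps)
  show "iso ?H (Assoc Kl X Y Z W a)"
    unfolding a(1) kleisli_simps
    by (rule category.iso_comp[OF J.cod.category_hom])
      (simp_all add: a s J.cod.iso_assoc J.cod.iso_rwhisk iso_mu)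
  show "Dom ?H (Assoc Kl X Y Z W a) = onOb ?L a" "Cod ?H (Assoc Kl X Y Z W a) = onOb ?R a"
    by (simp_all add: a s)
next
  fix c
  assume "c \<in> Ar ?P"
  then obtain \<gamma> \<beta> \<alpha> where c: "c = (\<gamma>, \<beta>, \<alpha>)" "\<gamma> \<in> Ar (JT Z W)" "\<beta> \<in> Ar (JT Y Z)" "\<alpha> \<in> Ar (JT X Y)"
    by (cases c) (auto simp: prod_cat_simps)
  note s = X Y Z W tsimps vassoc c
  let ?h0 = "Dom (JT Z W) \<gamma>" and ?g0 = "Dom (JT Y Z) \<beta>" and ?f0 = "Dom (JT X Y) \<alpha>"
    and ?h1 = "Cod (JT Z W) \<gamma>" and ?g1 = "Cod (JT Y Z) \<beta>" and ?f1 = "Cod (JT X Y) \<alpha>"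
  let ?A = "\<lambda>h g f. Assoc D (PObj J X) (TOb T Y) (TOb T Z) (TOb T W) (ext1 Z W h, ext1 Y Z g, f)"
  let ?M = "\<lambda>h g. Mu T Y Z W (h, g)"
  let ?rw = "rwhisk D (PObj J X) (TOb T Y) (TOb T W)"
  let ?c2 = "comp2 D (PObj J X) (TOb T Y) (TOb T W)"
  let ?s = "ext2 Y W (comp2 D (PObj J Y) (TOb T Z) (TOb T W) (ext2 Z W \<gamma>) \<beta>)"
  let ?t = "comp2 D (TOb T Y) (TOb T Z) (TOb T W) (ext2 Z W \<gamma>) (ext2 Y Z \<beta>)"
  let ?r = "comp2 D (PObj J X) (TOb T Z) (TOb T W) (ext2 Z W \<gamma>)
    (comp2 D (PObj J X) (TOb T Y) (TOb T Z) (ext2 Y Z \<beta>) \<alpha>)"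
  have "(?A ?h1 ?g1 ?f1 \<cdot>\<^bsub>?H\<^esub> ?rw (?M ?h1 ?g1) ?f1) \<cdot>\<^bsub>?H\<^esub> ?c2 ?s \<alpha>
      = ?A ?h1 ?g1 ?f1 \<cdot>\<^bsub>?H\<^esub> (?rw (?M ?h1 ?g1) ?f1 \<cdot>\<^bsub>?H\<^esub> ?c2 ?s \<alpha>)"
    by (simp add: s)
  \<comment> \<open>Absorbing the whisker lets naturality of \<mu> act inside the left argument of
    the horizontal composite; afterwards \<mu> is split off again, now on the source side.\<close>
  also have "?rw (?M ?h1 ?g1) ?f1 \<cdot>\<^bsub>?H\<^esub> ?c2 ?s \<alpha> = ?c2 (?M ?h1 ?g1 \<cdot>\<^bsub>TT Y W\<^esub> ?s) \<alpha>"
    by (rule J.cod.comp2_rwhisk_comp) (simp_all add: s)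
  also have "?M ?h1 ?g1 \<cdot>\<^bsub>TT Y W\<^esub> ?s = ?t \<cdot>\<^bsub>TT Y W\<^esub> ?M ?h0 ?g0"
    by (rule mu_natural) (simp_all add: s)
  also have "?c2 (?t \<cdot>\<^bsub>TT Y W\<^esub> ?M ?h0 ?g0) \<alpha> = ?c2 ?t \<alpha> \<cdot>\<^bsub>?H\<^esub> ?rw (?M ?h0 ?g0) ?f0"
    by (rule J.cod.comp2_rwhisk_comp[symmetric]) (simp_all add: s)
  also have "?A ?h1 ?g1 ?f1 \<cdot>\<^bsub>?H\<^esub> (?c2 ?t \<alpha> \<cdot>\<^bsub>?H\<^esub> ?rw (?M ?h0 ?g0) ?f0)
      = (?A ?h1 ?g1 ?f1 \<cdot>\<^bsub>?H\<^esub> ?c2 ?t \<alpha>) \<cdot>\<^bsub>?H\<^esub> ?rw (?M ?h0 ?g0) ?f0"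
    by (simp add: s)
  also have "?A ?h1 ?g1 ?f1 \<cdot>\<^bsub>?H\<^esub> ?c2 ?t \<alpha> = ?r \<cdot>\<^bsub>?H\<^esub> ?A ?h0 ?g0 ?f0"
    using J.cod.assoc_natural[of "PObj J X" "TOb T Y" "TOb T Z" "TOb T W" \<alpha> "ext2 Y Z \<beta>"
        "ext2 Z W \<gamma>"]
    by (simp add: s)
  also have "(?r \<cdot>\<^bsub>?H\<^esub> ?A ?h0 ?g0 ?f0) \<cdot>\<^bsub>?H\<^esub> ?rw (?M ?h0 ?g0) ?f0
      = ?r \<cdot>\<^bsub>?H\<^esub> (?A ?h0 ?g0 ?f0 \<cdot>\<^bsub>?H\<^esub> ?rw (?M ?h0 ?g0) ?f0)"
    by (simp add: s)
  finally show "Assoc Kl X Y Z W (Cod ?P c) \<cdot>\<^bsub>?H\<^esub> onAr ?L c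
      = onAr ?R c \<cdot>\<^bsub>?H\<^esub> Assoc Kl X Y Z W (Dom ?P c)"
    by (simp add: c(1) prod_cat_simps kleisli_simps kleisli_comp)
qed

text \<open>This is \<open>lunit_whisk_natural\<close> for \<theta>: left whiskering with
  \<open>TUnit T Y\<close> in Kl is left whiskering with its extension in D.\<close>

lemma kleisli_lunit_natural_iso:
  assumes X: "X \<in> Obj C" and Y: "Y \<in> Obj C"
  shows "natural_iso (JT X Y) (JT X Y) (postcomp_functor Kl X Y Y (TUnit T Y)) id_functor
    (LUnit Kl X Y)"
proof (rule natural_iso_arrI)
  note s = X Y tsimps kleisli_simps kleisli_comp kleisli_lwhisk postcomp_functor_def id_functor_def
  show "cat_functor (JT X Y) (JT X Y) (postcomp_functor Kl X Y Y (TUnit T Y))"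
    using Kl.postcomp_functor_cat_functor[of X Y Y "TUnit T Y"] by (simp add: X Y kleisli_simps t_unit)
  show "cat_functor (JT X Y) (JT X Y) id_functor"
    by (rule cat_functor_id) (simp add: s J.cod.category_hom)
  show "iso (JT X Y) (LUnit Kl X Y f)" if "f \<in> Ob (JT X Y)" for f
    unfolding kleisli_simps by (rule J.cod.iso_lunit_whisk) (simp_all add: s that theta_iso)
  show "Dom (JT X Y) (LUnit Kl X Y f) = onOb (postcomp_functor Kl X Y Y (TUnit T Y)) f"
    "Cod (JT X Y) (LUnit Kl X Y f) = onOb id_functor f" if "f \<in> Ob (JT X Y)" for f
    by (simp_all add: s that)
  show "LUnit Kl X Y (Cod (JT X Y) \<alpha>) \<cdot>\<^bsub>JT X Y\<^esub> onAr (postcomp_functor Kl X Y Y (TUnit T Y)) \<alpha>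
      = onAr id_functor \<alpha> \<cdot>\<^bsub>JT X Y\<^esub> LUnit Kl X Y (Dom (JT X Y) \<alpha>)" if "\<alpha> \<in> Ar (JT X Y)" for \<alpha>
    using J.cod.lunit_whisk_natural[of "PObj J X" "TOb T Y" "Theta T Y" _ \<alpha>] that by (simp add: s)
qed

text \<open>For \<open>TUnit T X\<close> the right-hand side is literally the target functor of
  \<eta>, which is why the pointwise inverse of \<eta> serves as the right unit of Kl.\<close>

lemma precomp_functor_kleisli:
  "precomp_functor Kl X Y Z f = precomp_functor D (PObj J X) (TOb T Y) (TOb T Z) f \<circ>\<^sub>F Ext T Y Z"
  by (auto simp: precomp_functor_def comp_functor_def kleisli_comp kleisli_rwhisk)

lemma kleisli_runit_natural_iso:
  assumes "X \<in> Obj C" "Y \<in> Obj C"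
  shows "natural_iso (JT X Y) (JT X Y) (precomp_functor Kl X X Y (TUnit T X)) id_functor
    (RUnit Kl X Y)"
proof -
  have "RUnit Kl X Y = (\<lambda>f. inv_of (JT X Y) (Eta T X Y f))"
    by (simp add: fun_eq_iff kleisli_simps)
  then show ?thesis
    using natural_iso.natural_iso_inv[OF eta_natural_iso[OF assms]]
    by (simp add: precomp_functor_kleisli)
qed

text \<open>Around the associativity axiom at g, h, k stand only facts about D: its pentagon at f
  and the extensions of g, h, k, and two naturality squares that move \<mu> past its
  associator.\<close>

lemma kleisli_pentagon:
  assumes X: "X \<in> Obj C" and Y: "Y \<in> Obj C" and Z: "Z \<in> Obj C" and W: "W \<in> Obj C"
    and V: "V \<in> Obj C" and f: "f \<in> Ob (JT X Y)" and g: "g \<in> Ob (JT Y Z)"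
    and h: "h \<in> Ob (JT Z W)" and k: "k \<in> Ob (JT W V)"
  shows "Assoc Kl X Z W V (k, h, comp1 Kl X Y Z g f)
      \<cdot>\<^bsub>JT X V\<^esub> Assoc Kl X Y Z V (comp1 Kl Z W V k h, g, f)
    = lwhisk Kl X W V k (Assoc Kl X Y Z W (h, g, f))
      \<cdot>\<^bsub>JT X V\<^esub> Assoc Kl X Y W V (k, comp1 Kl Y Z W h g, f)
      \<cdot>\<^bsub>JT X V\<^esub> rwhisk Kl X Y V (Assoc Kl Y Z W V (k, h, g)) f"
proof -
  let ?H = "JT X V"
  let ?k = "ext1 W V k" and ?h = "ext1 Z W h" and ?g = "ext1 Y Z g"
  let ?gf = "comp1 D (PObj J X) (TOb T Y) (TOb T Z) ?g f"
  let ?hg = "comp1 D (PObj J Y) (TOb T Z) (TOb T W) ?h g"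
  let ?kh = "comp1 D (PObj J Z) (TOb T W) (TOb T V) ?k h"
  let ?khc = "comp1 D (TOb T Z) (TOb T W) (TOb T V) ?k ?h"
  let ?hgc = "comp1 D (TOb T Y) (TOb T Z) (TOb T W) ?h ?g"
  let ?rwf = "\<lambda>\<beta>. rwhisk D (PObj J X) (TOb T Y) (TOb T V) \<beta> f"
  let ?lwk = "lwhisk D (PObj J X) (TOb T W) (TOb T V) ?k"
  let ?\<mu>f = "rwhisk D (PObj J X) (TOb T Y) (TOb T W) (Mu T Y Z W (h, g)) f"
  let ?\<mu>gc = "rwhisk D (TOb T Y) (TOb T Z) (TOb T V) (Mu T Z W V (k, h)) ?g"
  let ?k\<mu> = "lwhisk D (TOb T Y) (TOb T W) (TOb T V) ?k (Mu T Y Z W (h, g))"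
  let ?\<mu>gf = "rwhisk D (PObj J X) (TOb T Z) (TOb T V) (Mu T Z W V (k, h)) ?gf"
  let ?a1 = "Assoc D (PObj J X) (TOb T Z) (TOb T W) (TOb T V) (?k, ?h, ?gf)"
  let ?a2 = "Assoc D (PObj J X) (TOb T Y) (TOb T Z) (TOb T V)"
  let ?a3 = "Assoc D (PObj J X) (TOb T Y) (TOb T Z) (TOb T W) (?h, ?g, f)"
  let ?a4 = "Assoc D (PObj J X) (TOb T Y) (TOb T W) (TOb T V)"
  let ?a5 = "Assoc D (TOb T Y) (TOb T Z) (TOb T W) (TOb T V) (?k, ?h, ?g)"
  let ?w = "Assoc D (PObj J Y) (TOb T Z) (TOb T W) (TOb T V) (?k, ?h, g)
    \<cdot>\<^bsub>JT Y V\<^esub> rwhisk D (PObj J Y) (TOb T Z) (TOb T V) (Mu T Z W V (k, h)) g"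
  note s = X Y Z W V f g h k tsimps vassoc
  have "(?a1 \<cdot>\<^bsub>?H\<^esub> ?\<mu>gf) \<cdot>\<^bsub>?H\<^esub> (?a2 (ext1 Z V ?kh, ?g, f) \<cdot>\<^bsub>?H\<^esub> ?rwf (Mu T Y Z V (?kh, g)))
      = ?a1 \<cdot>\<^bsub>?H\<^esub> ((?\<mu>gf \<cdot>\<^bsub>?H\<^esub> ?a2 (ext1 Z V ?kh, ?g, f)) \<cdot>\<^bsub>?H\<^esub> ?rwf (Mu T Y Z V (?kh, g)))"
    by (simp add: s)
  \<comment> \<open>Moving \<mu> for k and h across the associator leaves two associators adjacent
    that form one side of the pentagon of D.\<close>
  also have "?\<mu>gf \<cdot>\<^bsub>?H\<^esub> ?a2 (ext1 Z V ?kh, ?g, f) = ?a2 (?khc, ?g, f) \<cdot>\<^bsub>?H\<^esub> ?rwf ?\<mu>gc"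
    using J.cod.assoc_natural_left[of "PObj J X" "TOb T Y" "TOb T Z" "TOb T V" f ?g
        "Mu T Z W V (k, h)"]
    by (simp add: s)
  also have "?a1 \<cdot>\<^bsub>?H\<^esub> ((?a2 (?khc, ?g, f) \<cdot>\<^bsub>?H\<^esub> ?rwf ?\<mu>gc) \<cdot>\<^bsub>?H\<^esub> ?rwf (Mu T Y Z V (?kh, g)))
      = (?a1 \<cdot>\<^bsub>?H\<^esub> ?a2 (?khc, ?g, f)) \<cdot>\<^bsub>?H\<^esub> (?rwf ?\<mu>gc \<cdot>\<^bsub>?H\<^esub> ?rwf (Mu T Y Z V (?kh, g)))"
    by (simp add: s)
  also have "?a1 \<cdot>\<^bsub>?H\<^esub> ?a2 (?khc, ?g, f) = ?lwk ?a3 \<cdot>\<^bsub>?H\<^esub> ?a4 (?k, ?hgc, f) \<cdot>\<^bsub>?H\<^esub> ?rwf ?a5"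
    by (rule J.cod.pentagon) (simp_all add: s)
  also have "(?lwk ?a3 \<cdot>\<^bsub>?H\<^esub> ?a4 (?k, ?hgc, f) \<cdot>\<^bsub>?H\<^esub> ?rwf ?a5)
        \<cdot>\<^bsub>?H\<^esub> (?rwf ?\<mu>gc \<cdot>\<^bsub>?H\<^esub> ?rwf (Mu T Y Z V (?kh, g)))
      = (?lwk ?a3 \<cdot>\<^bsub>?H\<^esub> ?a4 (?k, ?hgc, f))
        \<cdot>\<^bsub>?H\<^esub> ?rwf (?a5 \<cdot>\<^bsub>TT Y V\<^esub> ?\<mu>gc \<cdot>\<^bsub>TT Y V\<^esub> Mu T Y Z V (?kh, g))"
    by (simp add: s J.cod.rwhisk_comp)
  \<comment> \<open>The cell \<open>?a5\<close>, produced by the pentagon of D, is exactly the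
    associator that the associativity axiom requires next to the two cells \<mu>.\<close>
  also have "?a5 \<cdot>\<^bsub>TT Y V\<^esub> ?\<mu>gc \<cdot>\<^bsub>TT Y V\<^esub> Mu T Y Z V (?kh, g)
      = ?k\<mu> \<cdot>\<^bsub>TT Y V\<^esub> Mu T Y W V (k, ?hg) \<cdot>\<^bsub>TT Y V\<^esub> ext2 Y V ?w"
    by (rule t_assoc[symmetric]) (simp_all add: s)
  also have "(?lwk ?a3 \<cdot>\<^bsub>?H\<^esub> ?a4 (?k, ?hgc, f)) \<cdot>\<^bsub>?H\<^esub> ?rwf \<dots>
      = ?lwk ?a3 \<cdot>\<^bsub>?H\<^esub> ((?a4 (?k, ?hgc, f) \<cdot>\<^bsub>?H\<^esub> ?rwf ?k\<mu>)
        \<cdot>\<^bsub>?H\<^esub> (?rwf (Mu T Y W V (k, ?hg)) \<cdot>\<^bsub>?H\<^esub> ?rwf (ext2 Y V ?w)))"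
    by (simp add: s J.cod.rwhisk_comp)
  \<comment> \<open>With \<mu> for h and g brought outside the associator, it joins
    \<open>?a3\<close> under the whisker by \<open>?k\<close> to form an associator of Kl.\<close>
  also have "?a4 (?k, ?hgc, f) \<cdot>\<^bsub>?H\<^esub> ?rwf ?k\<mu> = ?lwk ?\<mu>f \<cdot>\<^bsub>?H\<^esub> ?a4 (?k, ext1 Y W ?hg, f)"
    using J.cod.assoc_natural_middle[of "PObj J X" "TOb T Y" "TOb T W" "TOb T V" f
        "Mu T Y Z W (h, g)" ?k]
    by (simp add: s)
  also have "?lwk ?a3 \<cdot>\<^bsub>?H\<^esub> ((?lwk ?\<mu>f \<cdot>\<^bsub>?H\<^esub> ?a4 (?k, ext1 Y W ?hg, f))
        \<cdot>\<^bsub>?H\<^esub> (?rwf (Mu T Y W V (k, ?hg)) \<cdot>\<^bsub>?H\<^esub> ?rwf (ext2 Y V ?w)))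
      = ?lwk (?a3 \<cdot>\<^bsub>JT X W\<^esub> ?\<mu>f)
        \<cdot>\<^bsub>?H\<^esub> (?a4 (?k, ext1 Y W ?hg, f) \<cdot>\<^bsub>?H\<^esub> ?rwf (Mu T Y W V (k, ?hg)))
        \<cdot>\<^bsub>?H\<^esub> ?rwf (ext2 Y V ?w)"
    by (simp add: s J.cod.lwhisk_comp)
  finally show ?thesis
    by (simp only: kleisli_simps kleisli_comp kleisli_rwhisk kleisli_lwhisk[OF W V k])
qed

lemma kleisli_triangle:
  assumes X: "X \<in> Obj C" and Y: "Y \<in> Obj C" and Z: "Z \<in> Obj C"
    and f: "f \<in> Ob (JT X Y)" and g: "g \<in> Ob (JT Y Z)"
  shows "lwhisk Kl X Y Z g (LUnit Kl X Y f) \<cdot>\<^bsub>JT X Z\<^esub> Assoc Kl X Y Y Z (g, TUnit T Y, f)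
    = rwhisk Kl X Y Z (RUnit Kl Y Z g) f"
  using whiskered_unit_law[of "PObj J X" Y Z g f] assms
  by (simp add: kleisli_simps kleisli_rwhisk kleisli_lwhisk J.p_obj)

lemma kleisli_bicategory: "bicategory Kl"
  by (rule bicategory.intro; unfold kleisli_simps(1-3))
    (rule Kl.category_hom[unfolded kleisli_simps] Kl.functor_hcomp[unfolded kleisli_simps(1-3)]
      t_unit kleisli_assoc_natural_iso kleisli_lunit_natural_iso kleisli_runit_natural_iso
      kleisli_pentagon kleisli_triangle; assumption)+

section \<open>The pseudofunctor from the Kleisli bicategory to D\<close>

lemma kleisli_pseudofunctor: "pseudofunctor Kl D (kleisli_pseudofunctor T)"
proof (rule pseudofunctor.intro[OF kleisli_bicategory J.cod.bicategory_axioms],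
    rule pseudofunctor_axioms.intro; unfold kleisli_simps(1-4); unfold kleisli_pseudofunctor_def;
    simp only: pseudofunctor_data.simps)
  fix X Y Z W f g h
  assume X: "X \<in> Obj C" and Y: "Y \<in> Obj C" and Z: "Z \<in> Obj C" and W: "W \<in> Obj C"
    and f: "f \<in> Ob (JT X Y)" and g: "g \<in> Ob (JT Y Z)" and h: "h \<in> Ob (JT Z W)"
  show "Assoc D (TOb T X) (TOb T Y) (TOb T Z) (TOb T W) (ext1 Z W h, ext1 Y Z g, ext1 X Y f)
      \<cdot>\<^bsub>TT X W\<^esub> rwhisk D (TOb T X) (TOb T Y) (TOb T W) (Mu T Y Z W (h, g)) (ext1 X Y f)
      \<cdot>\<^bsub>TT X W\<^esub> Mu T X Y W (comp1 Kl Y Z W h g, f)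
    = lwhisk D (TOb T X) (TOb T Z) (TOb T W) (ext1 Z W h) (Mu T X Y Z (g, f))
      \<cdot>\<^bsub>TT X W\<^esub> Mu T X Z W (h, comp1 Kl X Y Z g f)
      \<cdot>\<^bsub>TT X W\<^esub> ext2 X W (Assoc Kl X Y Z W (h, g, f))"
    \<comment> \<open>The cell that the associativity axiom has under \<open>Ext\<close> is the
      associator of Kl, so only the sides have to be exchanged.\<close>
    unfolding kleisli_simps kleisli_comp by (rule t_assoc[OF X Y Z W f g h, symmetric])
next
  fix X Y f
  assume XY: "X \<in> Obj C" "Y \<in> Obj C" "f \<in> Ob (JT X Y)"
  show "LUnit D (TOb T X) (TOb T Y) (ext1 X Y f)
      \<cdot>\<^bsub>TT X Y\<^esub> rwhisk D (TOb T X) (TOb T Y) (TOb T Y) (Theta T Y) (ext1 X Y f)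
      \<cdot>\<^bsub>TT X Y\<^esub> Mu T X Y Y (TUnit T Y, f)
    = ext2 X Y (LUnit Kl X Y f)"
    unfolding kleisli_simps by (rule ext2_left_unit) fact+
  show "RUnit D (TOb T X) (TOb T Y) (ext1 X Y f)
      \<cdot>\<^bsub>TT X Y\<^esub> lwhisk D (TOb T X) (TOb T X) (TOb T Y) (ext1 X Y f) (Theta T X)
      \<cdot>\<^bsub>TT X Y\<^esub> Mu T X X Y (f, TUnit T X)
    = ext2 X Y (RUnit Kl X Y f)"
    unfolding kleisli_simps unit_law_inverse[OF XY, symmetric] using XY by (simp add: tsimps vassoc)
qed (fact t_obj ext_functor mu_natural_iso theta theta_iso)+

section \<open>The adjoint equivalences on hom-categories\<close>

lemma kleisli_hom_adjoint_equivalence: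
  assumes X: "X \<in> Obj C" and A: "A \<in> Obj C"
  shows "adjoint_equivalence (JT X A) (JT X A) id_functor
    (precomp_functor D (PObj J X) (TOb T X) (TOb T A) (TUnit T X) \<circ>\<^sub>F Ext T X A)
    (Eta T X A) (\<lambda>f. inv_of (JT X A) (Eta T X A f))"
    (is "adjoint_equivalence _ _ _ ?R _ _")
proof -
  interpret eta: natural_iso "JT X A" "JT X A" id_functor ?R "Eta T X A"
    by (rule eta_natural_iso) fact+
  interpret inv: natural_iso "JT X A" "JT X A" ?R id_functor
      "\<lambda>f. inv_of (JT X A) (Eta T X A f)"
    by (rule eta.natural_iso_inv)
  have id: "?R \<circ>\<^sub>F id_functor = ?R" "id_functor \<circ>\<^sub>F ?R = ?R"
    by (simp_all add: comp_functor_def id_functor_def fun_eq_iff)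
  have on_id: "onOb id_functor f = f" "onAr id_functor \<alpha> = \<alpha>" for f \<alpha>
    by (simp_all add: id_functor_def)
  have left: "inv_of (JT X A) (Eta T X A (onOb id_functor f))
      \<cdot>\<^bsub>JT X A\<^esub> onAr id_functor (Eta T X A f) = Idn (JT X A) (onOb id_functor f)"
    if f: "f \<in> Ob (JT X A)" for f
    using eta.F.dom.inv_of_comp[OF eta.component_iso[OF f]] eta.dom_component[OF f]
    by (simp add: on_id)
  have right: "onAr ?R (inv_of (JT X A) (Eta T X A f)) \<cdot>\<^bsub>JT X A\<^esub> Eta T X A (onOb ?R f)
      = Idn (JT X A) (onOb ?R f)"
    if f: "f \<in> Ob (JT X A)" for f
  proof -
    note iso = eta.component_iso[OF f]
    \<comment> \<open>The naturality square of \<eta> is taken at the inverse of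
      \<open>Eta T X A f\<close>, a 2-cell from \<open>onOb ?R f\<close> to \<open>f\<close>: one
      leg is the triangle composite, the other is \<eta> after its inverse.\<close>
    have "onAr ?R (inv_of (JT X A) (Eta T X A f)) \<cdot>\<^bsub>JT X A\<^esub> Eta T X A (onOb ?R f)
        = Eta T X A f \<cdot>\<^bsub>JT X A\<^esub> inv_of (JT X A) (Eta T X A f)"
      using eta.natural_arr[OF eta.F.dom.inv_of_arr[OF iso]] f
      by (simp add: on_id eta.F.dom.dom_inv_of[OF iso] eta.F.dom.cod_inv_of[OF iso]
          eta.dom_component eta.cod_component)
    also have "\<dots> = Idn (JT X A) (onOb ?R f)"
      using eta.F.dom.comp_inv_of[OF iso] eta.cod_component[OF f] by simp
    finally show ?thesis .
  qed
  show ?thesis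
    unfolding adjoint_equivalence_def adjoint_equivalence_axioms_def id
    using left right eta.F.cat_functor_axioms eta.G.cat_functor_axioms eta.natural_iso_axioms
      inv.natural_iso_axioms
    by blast
qed

lemma kleisli_relative_left_pseudoadjoint:
  "relative_left_pseudoadjoint C D Kl J (kleisli_pseudofunctor T)
    \<lparr>FOb = (\<lambda>X. X), FUnit = TUnit T, Sharp = (\<lambda>X A. id_functor), AUnit = Eta T,
      ACounit = (\<lambda>X A f. inv_of (JT X A) (Eta T X A f))\<rparr>"
  by (rule relative_left_pseudoadjoint.intro[OF J.pseudofunctor_axioms kleisli_pseudofunctor],
      rule relative_left_pseudoadjoint_axioms.intro)
    (simp_all add: kleisli_simps kleisli_pseudofunctor_def t_unit kleisli_hom_adjoint_equivalence)

end

theorem theorem4p4: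
  fixes C :: "('co, 'cm, 'cc) bicat_data"
    and D :: "('o, 'm, 'c) bicat_data"
    and J :: "('co, 'cm, 'cc, 'o, 'm, 'c) pseudofunctor_data"
    and T :: "('co, 'o, 'm, 'c) rel_pseudomonad_data"
  assumes "bicategory C" and "bicategory D"
    and "pseudofunctor C D J"
    and "relative_pseudomonad C D J T"
  shows "\<exists>F. relative_left_pseudoadjoint C D (kleisli_bicat C D J T) J (kleisli_pseudofunctor T) F"
  using relative_pseudomonad.kleisli_relative_left_pseudoadjoint[OF assms(4)] by (rule exI)

end
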